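(* Let $p\ge 1$ be an integer and let $\mu_0,\ldots,\mu_p$ be Borel probability measures with compact support in $\mathbb{C}$. Let $\mathcal{A}=(a^{(0)},\ldots,a^{(p)})$ and $\mathcal{B}=(b^{(0)},\ldots,b^{(p)})$ be two independent collections of random sequences $a^{(k)}=(a_n^{(k)})_{n\ge 1}$, $b^{(k)}=(b_n^{(k)})_{n\geq 1}$, where for each $0\le k\le p$ the sequences $a^{(k)}$ and $b^{(k)}$ are each i.i.d. with distribution $\mu_k$, the whole collection $\{a_n^{(k)}: n\ge 1, 0\le k\le p\}$ is jointly independent, and likewise the whole collection $\{b_n^{(k)}: n\ge 1, 0\le k\le p\}$ is jointly independent. Let $\Phi(\mathcal{A})=(\phi_0,\ldots,\phi_p)$ and $\Phi(\mathcal{B})=(\psi_0,\ldots,\psi_p)$ be the associated systems of Weyl functions. Let $\alpha=(\alpha_j^{(k)})_{0\le j\le k\le p}$ be a triangular array of independent random variables, where $\alpha_j^{(k)}$ has distribution $\mu_k$ for all $j$ and $k$, and such that $\alpha$ is independent of $(\mathcal{A},\mathcal{B})$. All these random variables are assumed to be surely bounded in modulus by an absolute constant. Let $\sigma_n=\frac1n\sum_{i=1}^n\delta_{\lambda_{i,n}}$, where $\lambda_{1,n},\ldots,\lambda_{n,n}$ are the eigenvalues, counted with multiplicity, of the $n\times n$ matrix $H_n$ built from $\mathcal{A}$. Then for each integer $\ell\ge 0$, $$\lim_{n\to\infty}\mathbb{E}\left(\int x^{\ell}\,d\sigma_n(x)\right)=\mathbb{E}([W]_{\ell+1}),$$ where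 $$W(z)=\frac{1}{z-\sum_{k=0}^{p}\sum_{j=0}^{k}\alpha_j^{(k)}\,\phi_{k-j}(z)\,\psi_j(z)}.$$
   Context: Given bounded sequences $\mathcal{A}=(a^{(0)},\ldots,a^{(p)})$, $a^{(k)}=(a^{(k)}_n)_{n\ge1}$, let $H=(h_{i,j})_{i,j\ge 1}$ be the infinite banded lower Hessenberg matrix with $h_{j-1,j}=1$ for $j\ge 2$; $h_{j+k,j}=a_j^{(k)}$ for $0\le k\le p$, $j\ge1$; and $h_{i,j}=0$ otherwise. $H_n=(h_{i,j})_{1\le i,j\le n}$ is its principal $n\times n$ truncation. Let $\{e_n\}_{n\ge1}$ be the standard orthonormal basis of $\ell^2(\mathbb{N})$ and let $\mathcal{H}$ be the bounded operator on $\ell^2(\mathbb{N})$ with $\langle\mathcal{H}e_j,e_i\rangle=h_{i,j}$. The associated system of Weyl functions $\Phi(\mathcal{A})=(\phi_0,\phi_1,\ldots,\phi_p)$ is defined by $\phi_0\equiv 1$ and $\phi_j(z)=\langle (zI-\mathcal{H})^{-1}e_j,e_1\rangle$ for $1\le j\le p$. $\Phi(\mathcal{B})$ is defined in the same way with $\mathcal{B}$ in place of $\mathcal{A}$. For a Laurent series $f(z)=\sum_{k\in\mathbb{Z}}c_kz^{-k}$ write $[f]_k=c_k$; $[W]_{k}$ refers to the Laurent expansion of $W$ at infinity. *)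

theory Defs
  imports
    "HOL-Probability.Probability"
    "HOL-Complex_Analysis.Complex_Analysis"
    "Jordan_Normal_Form.Char_Poly"
begin

section \<open>Banded lower Hessenberg matrices\<close>

text \<open>
  A collection of sequences is a function \<open>a\<close>, where \<open>a k n\<close> is the \<open>n\<close>-th term of the
  \<open>k\<close>-th sequence; a triangular array is a function \<open>\<alpha>\<close>, where \<open>\<alpha> k j\<close> has upper index \<open>k\<close> and
  lower index \<open>j\<close>. As in the mathematical text, \<open>n\<close> and the matrix indices \<open>i, j\<close> start at 1.
\<close>

definition seq_index :: "nat \<Rightarrow> (nat \<times> nat) set" where
  "seq_index p = {0..p} \<times> {1..}"

definition tri_index :: "nat \<Rightarrow> (nat \<times> nat) set" where
  "tri_index p = {(k, j). j \<le> k \<and> k \<le> p}"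

definition hess_entry :: "nat \<Rightarrow> (nat \<Rightarrow> nat \<Rightarrow> complex) \<Rightarrow> nat \<Rightarrow> nat \<Rightarrow> complex" where
  "hess_entry p a i j =
     (if j = i + 1 then 1 else if j \<le> i \<and> i \<le> j + p then a (i - j) j else 0)"

text \<open>Matrices of type \<open>complex mat\<close> are indexed from 0, hence the shift.\<close>

definition hess_mat :: "nat \<Rightarrow> (nat \<Rightarrow> nat \<Rightarrow> complex) \<Rightarrow> nat \<Rightarrow> complex mat" where
  "hess_mat p a n = mat n n (\<lambda>(i, j). hess_entry p a (Suc i) (Suc j))"

text \<open>
  The multiset of roots of the characteristic polynomial is the multiset of eigenvalues counted
  with (algebraic) multiplicity, and the uniform distribution on a multiset weights each element
  by its multiplicity. The definition is meaningful for matrices of size at least 1.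
\<close>

definition eigenvalue_distribution :: "complex mat \<Rightarrow> complex pmf" where
  "eigenvalue_distribution A = pmf_of_multiset (proots (char_poly A))"


section \<open>The operator on square-summable sequences\<close>

text \<open>
  Coordinate \<open>n\<close> of an element of \<open>l2\<close> is the coefficient of the basis vector \<open>l2_basis (n + 1)\<close>,
  so that basis vectors are numbered from 1.
\<close>

definition l2 :: "(nat \<Rightarrow> complex) set" where
  "l2 = {x. summable (\<lambda>n. (cmod (x n))\<^sup>2)}"

definition l2_inner :: "(nat \<Rightarrow> complex) \<Rightarrow> (nat \<Rightarrow> complex) \<Rightarrow> complex" where
  "l2_inner x y = (\<Sum>n. x n * cnj (y n))"

definition l2_basis :: "nat \<Rightarrow> nat \<Rightarrow> complex" where
  "l2_basis j = (\<lambda>n. if Suc n = j then 1 else 0)"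

text \<open>Every row of the matrix has finitely many nonzero entries, so the series is a finite sum.\<close>

definition hess_op :: "nat \<Rightarrow> (nat \<Rightarrow> nat \<Rightarrow> complex) \<Rightarrow> (nat \<Rightarrow> complex) \<Rightarrow> nat \<Rightarrow> complex" where
  "hess_op p a x = (\<lambda>i. \<Sum>j. hess_entry p a (Suc i) (Suc j) * x j)"

text \<open>
  The inverse of \<open>z I - T\<close> on \<open>l2\<close>. It is the resolvent whenever \<open>z I - T\<close> is a bijection of \<open>l2\<close>;
  for a bounded linear operator \<open>T\<close> this is the case for all \<open>z\<close> of large modulus.
\<close>

definition l2_resolvent ::
    "((nat \<Rightarrow> complex) \<Rightarrow> nat \<Rightarrow> complex) \<Rightarrow> complex \<Rightarrow> (nat \<Rightarrow> complex) \<Rightarrow> nat \<Rightarrow> complex" where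
  "l2_resolvent T z = inv_into l2 (\<lambda>x n. z * x n - T x n)"

definition weyl :: "nat \<Rightarrow> (nat \<Rightarrow> nat \<Rightarrow> complex) \<Rightarrow> nat \<Rightarrow> complex \<Rightarrow> complex" where
  "weyl p a j z =
     (if j = 0 then 1
      else l2_inner (l2_resolvent (hess_op p a) z (l2_basis j)) (l2_basis 1))"

definition W_fun ::
    "nat \<Rightarrow> (nat \<Rightarrow> nat \<Rightarrow> complex) \<Rightarrow> (nat \<Rightarrow> nat \<Rightarrow> complex) \<Rightarrow> (nat \<Rightarrow> nat \<Rightarrow> complex)
      \<Rightarrow> complex \<Rightarrow> complex" where
  "W_fun p \<alpha> a b z =
     1 / (z - (\<Sum>k=0..p. \<Sum>j=0..k. \<alpha> k j * weyl p a (k - j) z * weyl p b j z))"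

text \<open>
  The coefficient of \<open>z\<close> to the power \<open>- k\<close> in the Laurent expansion of \<open>f\<close> at infinity, that is,
  the coefficient of \<open>w\<close> to the power \<open>k\<close> in the expansion of \<open>f (1 / w)\<close> at 0. Only the values of
  \<open>f\<close> at points of large modulus matter.
\<close>

definition laurent_coeff_infinity :: "(complex \<Rightarrow> complex) \<Rightarrow> int \<Rightarrow> complex" where
  "laurent_coeff_infinity f k = fls_nth (laurent_expansion (\<lambda>w. f (1 / w)) 0) k"

definition measure_support :: "'a::topological_space measure \<Rightarrow> 'a set" where
  "measure_support \<mu> = {x. \<forall>U. open U \<longrightarrow> x \<in> U \<longrightarrow> emeasure \<mu> U > 0}"


section \<open>Independence of two random elements\<close>

text \<open>
  The library constant \<open>prob_space.indep_var\<close> requires both random elements to take values in the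
  same type. This is the same notion (independence of the generated sigma-algebras) for random
  elements with values in different types.
\<close>

definition indep_random_elements ::
    "'w measure \<Rightarrow> 'a measure \<Rightarrow> ('w \<Rightarrow> 'a) \<Rightarrow> 'b measure \<Rightarrow> ('w \<Rightarrow> 'b) \<Rightarrow> bool" where
  "indep_random_elements M S X T Y \<longleftrightarrow>
     X \<in> measurable M S \<and> Y \<in> measurable M T \<and>
     prob_space.indep_set M
       (sigma_sets (space M) {X -` A \<inter> space M | A. A \<in> sets S})
       (sigma_sets (space M) {Y -` A \<inter> space M | A. A \<in> sets T})"

lemma indep_random_elements_iff_indep_var:
  assumes "prob_space M"
  shows "indep_random_elements M S X T Y \<longleftrightarrow> prob_space.indep_var M S X T Y"
  unfolding indep_random_elements_def prob_space.indep_var_eq[OF assms] by auto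


section \<open>\<open>hess_op\<close> is the bounded operator with the prescribed matrix entries\<close>

lemma l2_basis_in_l2: "l2_basis j \<in> l2"
proof -
  have "summable (\<lambda>n. (cmod (l2_basis j n))\<^sup>2)"
    by (rule summable_finite[of "{j - 1}"]) (auto simp: l2_basis_def)
  then show ?thesis by (simp add: l2_def)
qed

lemma l2_inner_basis: "j \<ge> 1 \<Longrightarrow> l2_inner x (l2_basis j) = x (j - 1)"
  unfolding l2_inner_def by (subst suminf_finite[of "{j - 1}"]) (auto simp: l2_basis_def)

lemma hess_op_matrix_entry:
  assumes "i \<ge> 1" "j \<ge> 1"
  shows "l2_inner (hess_op p a (l2_basis j)) (l2_basis i) = hess_entry p a i j"
proof -
  have "hess_op p a (l2_basis j) (i - 1) = hess_entry p a i j"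
    unfolding hess_op_def using assms
    by (subst suminf_finite[of "{j - 1}"]) (auto simp: l2_basis_def)
  then show ?thesis using assms by (simp add: l2_inner_basis)
qed

lemma hess_op_eq:
  "hess_op p a x i =
     x (Suc i) + (\<Sum>k\<le>p. if k \<le> i then a k (Suc (i - k)) * x (i - k) else 0)"
proof -
  have "hess_op p a x i = (\<Sum>j\<le>Suc i. hess_entry p a (Suc i) (Suc j) * x j)"
    unfolding hess_op_def by (rule suminf_finite) (auto simp: hess_entry_def)
  also have "\<dots> = x (Suc i) + (\<Sum>j\<le>i. hess_entry p a (Suc i) (Suc j) * x j)"
    by (simp add: hess_entry_def)
  also have "(\<Sum>j\<le>i. hess_entry p a (Suc i) (Suc j) * x j)
      = (\<Sum>j\<in>{j. j \<le> i \<and> i \<le> j + p}. a (i - j) (Suc j) * x j)"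
    by (rule sum.mono_neutral_cong_right) (auto simp: hess_entry_def)
  also have "\<dots> = (\<Sum>k\<in>{k. k \<le> p \<and> k \<le> i}. a k (Suc (i - k)) * x (i - k))"
    by (rule sum.reindex_bij_witness[of _ "\<lambda>k. i - k" "\<lambda>j. i - j"]) auto
  also have "\<dots> = (\<Sum>k\<le>p. if k \<le> i then a k (Suc (i - k)) * x (i - k) else 0)"
    by (rule sum.mono_neutral_cong_left) auto
  finally show ?thesis .
qed

lemma shift_sums:
  fixes f :: "nat \<Rightarrow> real"
  assumes "summable f"
  shows "(\<lambda>i. if k \<le> i then f (i - k) else 0) sums (\<Sum>n. f n)"
proof -
  have "(\<lambda>i. if k \<le> i + k then f (i + k - k) else 0) sums (\<Sum>n. f n)"
    using assms by (simp add: summable_sums)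
  then show ?thesis
    by (subst (asm) sums_iff_shift) (simp add: sum.neutral)
qed

lemma hess_op_bounded:
  assumes "\<And>k n. k \<le> p \<Longrightarrow> n \<ge> 1 \<Longrightarrow> cmod (a k n) \<le> C"
  obtains K where "\<And>x. x \<in> l2 \<Longrightarrow> hess_op p a x \<in> l2 \<and>
     (\<Sum>n. (cmod (hess_op p a x n))\<^sup>2) \<le> K * (\<Sum>n. (cmod (x n))\<^sup>2)"
proof
  fix x assume x: "x \<in> l2"
  define S where "S = (\<Sum>n. (cmod (x n))\<^sup>2)"
  have sx: "summable (\<lambda>n. (cmod (x n))\<^sup>2)" using x by (simp add: l2_def)
  define g where "g = (\<lambda>k i. if k \<le> i then (cmod (x (i - k)))\<^sup>2 else 0)"
  define B where "B = (\<lambda>i. 2 * (cmod (x (Suc i)))\<^sup>2 + 2 * (real (Suc p) * (C\<^sup>2 * (\<Sum>k\<le>p. g k i))))"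
  have pw: "(cmod (hess_op p a x i))\<^sup>2 \<le> B i" for i
  proof -
    let ?t = "\<lambda>k. if k \<le> i then a k (Suc (i - k)) * x (i - k) else 0"
    have "cmod (\<Sum>k\<le>p. ?t k) \<le> (\<Sum>k\<le>p. cmod (?t k))" by (rule norm_sum)
    then have "(cmod (\<Sum>k\<le>p. ?t k))\<^sup>2 \<le> (\<Sum>k\<le>p. cmod (?t k))\<^sup>2"
      by (rule power_mono) simp
    also have "\<dots> \<le> real (Suc p) * (\<Sum>k\<le>p. (cmod (?t k))\<^sup>2)"
      using sum_squared_le_sum_of_squares[of "\<lambda>k. cmod (?t k)" "{..p}"] by (simp add: mult.commute)
    also have "(\<Sum>k\<le>p. (cmod (?t k))\<^sup>2) \<le> (\<Sum>k\<le>p. C\<^sup>2 * g k i)"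
    proof (rule sum_mono)
      fix k assume "k \<in> {..p}"
      then have "(cmod (a k (Suc (i - k))))\<^sup>2 \<le> C\<^sup>2"
        using assms by (intro power_mono) auto
      then show "(cmod (?t k))\<^sup>2 \<le> C\<^sup>2 * g k i"
        by (auto simp: g_def norm_mult power_mult_distrib intro!: mult_right_mono)
    qed
    finally have t: "(cmod (\<Sum>k\<le>p. ?t k))\<^sup>2 \<le> real (Suc p) * (C\<^sup>2 * (\<Sum>k\<le>p. g k i))"
      by (simp add: sum_distrib_left mult_left_mono)
    have "cmod (hess_op p a x i) \<le> cmod (x (Suc i)) + cmod (\<Sum>k\<le>p. ?t k)"
      unfolding hess_op_eq by (rule norm_triangle_ineq)
    then have "(cmod (hess_op p a x i))\<^sup>2 \<le> (cmod (x (Suc i)) + cmod (\<Sum>k\<le>p. ?t k))\<^sup>2"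
      by (rule power_mono) simp
    also have "\<dots> \<le> 2 * (cmod (x (Suc i)))\<^sup>2 + 2 * (cmod (\<Sum>k\<le>p. ?t k))\<^sup>2"
      using zero_le_power2[of "cmod (x (Suc i)) - cmod (\<Sum>k\<le>p. ?t k)"]
      by (simp add: power2_eq_square algebra_simps)
    finally show ?thesis using t by (simp add: B_def)
  qed
  have s1: "(\<lambda>i. (cmod (x (Suc i)))\<^sup>2) sums (S - (cmod (x 0))\<^sup>2)"
    using sx unfolding S_def by (subst sums_Suc_iff) (simp add: summable_sums)
  have "(\<lambda>i. g k i) sums S" for k
    unfolding g_def S_def using shift_sums[OF sx, of k] by simp
  then have s2: "(\<lambda>i. \<Sum>k\<le>p. g k i) sums (\<Sum>k\<le>p. S)" by (intro sums_sum) auto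
  have sB: "B sums (2 * (S - (cmod (x 0))\<^sup>2) + 2 * (real (Suc p) * (C\<^sup>2 * (\<Sum>k\<le>p. S))))"
    unfolding B_def by (intro sums_add sums_mult s1 s2)
  have sH: "summable (\<lambda>i. (cmod (hess_op p a x i))\<^sup>2)"
    by (rule summable_comparison_test'[OF sums_summable[OF sB], of 0]) (use pw in auto)
  have "(\<Sum>i. (cmod (hess_op p a x i))\<^sup>2) \<le> (\<Sum>i. B i)"
    by (intro suminf_le pw sH sums_summable[OF sB])
  also have "\<dots> \<le> 2 * S + 2 * (real (Suc p) * (C\<^sup>2 * (\<Sum>k\<le>p. S)))"
    unfolding sums_unique[OF sB, symmetric] by simp
  also have "\<dots> = (2 + 2 * (real (Suc p) * C)\<^sup>2) * S"
    by (simp add: power2_eq_square algebra_simps)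
  finally show "hess_op p a x \<in> l2 \<and>
      (\<Sum>n. (cmod (hess_op p a x n))\<^sup>2) \<le> (2 + 2 * (real (Suc p) * C)\<^sup>2) * (\<Sum>n. (cmod (x n))\<^sup>2)"
    using sH by (simp add: l2_def S_def)
qed

end

theory Submission
  imports
    Defs
    "Jordan_Normal_Form.Schur_Decomposition"
begin

text \<open>
  Both sides of the limit are expected total weights of closed walks on \<open>\<int>\<close>, up to an error that
  vanishes as \<open>n\<close> grows.

  A walk that stands at \<open>j\<close> may move to \<open>j - 1\<close>, with weight 1, or to \<open>j + k\<close> for some \<open>0 \<le> k \<le>
  p\<close>, with a weight \<open>x k j\<close>. The \<open>l\<close>-th moment of \<open>\<sigma>\<^sub>n\<close> is the normalized trace of the \<open>l\<close>-th
  power of \<open>H\<^sub>n\<close>, and the \<open>i\<close>-th diagonal entry of this power is the total weight of the walks of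
  length \<open>l\<close> from \<open>i\<close> to \<open>i\<close> that stay in \<open>{1..n}\<close>, where \<open>x k j = a\<^sub>j\<^bsup>(k)\<^esup>\<close>. Unless \<open>i\<close> is within
  a distance, independent of \<open>n\<close>, of 1 or \<open>n\<close>, the confinement does not exclude any walk. The
  expectation is then that of the total weight of all closed walks of length \<open>l\<close> at 0 on \<open>\<int>\<close>, for
  independent weights \<open>x k j\<close> with distribution \<open>\<mu> k\<close>. Boundedly many of the \<open>n\<close> diagonal entries
  are excluded and all of them are bounded, so this expectation is the limit.

  The coefficient of \<open>W\<close> at \<open>z\<close> to the power \<open>- (l + 1)\<close> is, outcome by outcome, the total weight
  of the closed walks of length \<open>l\<close> at 0 for one particular array of weights. Indeed \<open>\<phi>\<^sub>j\<close>
  generates the walks that start at \<open>j\<close> and stay positive until they first reach 0: powers of the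
  operator generate the walks from \<open>j\<close> to 1, and the last step leads from 1 to 0. A closed walk
  that leaves 0 downwards must return to the nonnegative numbers by a jump from some \<open>- j\<close> to \<open>k -
  j \<ge> 0\<close>; before the jump it runs, read backwards and reflected, like a walk generated by \<open>\<psi>\<^sub>j\<close>,
  and after it like one generated by \<open>\<phi>\<^bsub>k - j\<^esub>\<close>. Hence the double sum in the denominator of \<open>W\<close>
  generates the first returns to 0, provided that the weights are \<open>a\<close> at positive positions, \<open>\<alpha>\<close>
  for the jumps that land at or cross 0 from a nonpositive position, and \<open>b\<close>, reflected, for the
  jumps between negative positions. These three groups use disjoint sets of variables, so the
  array \<open>two_sided\<close> so composed is again independent with the right marginals
  (\<open>two_sided_indep_vars\<close>), and both sides agree in expectation.

  The identity for generating functions is \<open>closed_walk_series\<close>. It is proved from the linear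
  recursions that the three kinds of series satisfy, without decomposing individual walks;
  \<open>laurent_coeff_W_fun\<close> supplies the passage from the operator to formal power series.
\<close>

section \<open>Weighted walks on the integers\<close>

text \<open>
  The total weight of the walks of length \<open>l\<close> from \<open>j\<close> to 0. The weight \<open>d\<close> of the downward steps
  is kept variable so that walks confined to an interval, for which some steps have weight 0, are
  covered.
\<close>

fun walk :: "nat \<Rightarrow> (int \<Rightarrow> complex) \<Rightarrow> (nat \<Rightarrow> int \<Rightarrow> complex) \<Rightarrow> nat \<Rightarrow> int \<Rightarrow> complex" where
  "walk p d x 0 j = (if j = 0 then 1 else 0)"
| "walk p d x (Suc l) j = d j * walk p d x l (j - 1) + (\<Sum>k\<le>p. x k j * walk p d x l (j + int k))"

text \<open>
  Each step changes the position by at most \<open>p + 1\<close>, so only weights near the starting point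
  matter.
\<close>

lemma walk_local:
  assumes "\<And>m. \<bar>m - j\<bar> \<le> int (l * p + l) \<Longrightarrow> d m = d' m"
    and "\<And>k m. k \<le> p \<Longrightarrow> \<bar>m - j\<bar> \<le> int (l * p + l) \<Longrightarrow> x k m = x' k m"
  shows "walk p d x l j = walk p d' x' l j"
  using assms
proof (induction l arbitrary: j)
  case (Suc l)
  have "walk p d x l (j - 1) = walk p d' x' l (j - 1)"
    by (rule Suc.IH; rule Suc.prems) auto
  moreover have "walk p d x l (j + int k) = walk p d' x' l (j + int k)" if "k \<le> p" for k
    by (rule Suc.IH; rule Suc.prems) (use that in auto)
  moreover have "d j = d' j" "\<And>k. k \<le> p \<Longrightarrow> x k j = x' k j"
    by (auto intro!: Suc.prems)
  ultimately show ?case by simp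
qed simp

lemma walk_bound:
  assumes "\<And>m. cmod (d m) \<le> K" "\<And>k m. k \<le> p \<Longrightarrow> cmod (x k m) \<le> K"
  shows "cmod (walk p d x l j) \<le> (real (p + 2) * K) ^ l"
proof (induction l arbitrary: j)
  case (Suc l)
  have K: "K \<ge> 0" using norm_ge_zero[of "d 0"] assms(1)[of 0] by linarith
  let ?B = "(real (p + 2) * K) ^ l"
  have B: "?B \<ge> 0" using K by simp
  have "cmod (walk p d x (Suc l) j) \<le> cmod (d j * walk p d x l (j - 1)) +
      (\<Sum>k\<le>p. cmod (x k j * walk p d x l (j + int k)))"
    unfolding walk.simps by (intro norm_triangle_le add_left_mono norm_sum)
  also have "\<dots> \<le> K * ?B + (\<Sum>k\<le>p. K * ?B)"
    unfolding norm_mult using assms Suc.IH K by (intro add_mono sum_mono mult_mono) auto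
  finally show ?case by (simp add: algebra_simps)
qed simp

lemma walk_measurable:
  assumes "\<And>k m. k \<le> p \<Longrightarrow> (\<lambda>\<omega>. x \<omega> k m) \<in> borel_measurable M"
  shows "(\<lambda>\<omega>. walk p d (x \<omega>) l j) \<in> borel_measurable M"
proof (induction l arbitrary: j)
  case (Suc l)
  show ?case unfolding walk.simps
    by (intro borel_measurable_add borel_measurable_times borel_measurable_sum Suc.IH assms) auto
qed simp

text \<open>
  Splitting off the first step of a walk, as an equation between generating functions in the
  length.
\<close>

lemma walk_fps:
  "Abs_fps (\<lambda>l. walk p (\<lambda>_. 1) x l j) = (if j = 0 then 1 else 0) +
     fps_X * (Abs_fps (\<lambda>l. walk p (\<lambda>_. 1) x l (j - 1)) +
       (\<Sum>k\<le>p. fps_const (x k j) * Abs_fps (\<lambda>l. walk p (\<lambda>_. 1) x l (j + int k))))"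
proof (rule fps_ext)
  fix n
  show "fps_nth (Abs_fps (\<lambda>l. walk p (\<lambda>_. 1) x l j)) n = fps_nth ((if j = 0 then 1 else 0) +
     fps_X * (Abs_fps (\<lambda>l. walk p (\<lambda>_. 1) x l (j - 1)) +
       (\<Sum>k\<le>p. fps_const (x k j) * Abs_fps (\<lambda>l. walk p (\<lambda>_. 1) x l (j + int k))))) n"
    by (cases n) (auto simp: fps_sum_nth)
qed

section \<open>Decomposition of closed walks at the origin\<close>

text \<open>
  Each use of the recursion gains a factor \<open>fps_X\<close>, which makes the map a contraction: all
  coefficients vanish, by induction on their index and for all positions at once.
\<close>

lemma half_line_recursion_unique:
  fixes D :: "nat \<Rightarrow> complex fps"
  assumes "D 0 = 0"
    and "\<And>j. D (Suc j) = fps_X * (D j + (\<Sum>k\<le>p. fps_const (c k j) * D (Suc j + k)))"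
  shows "D j = 0"
proof -
  have "\<forall>j. fps_nth (D j) n = 0" for n
  proof (induction n)
    case 0
    show ?case
    proof
      fix j show "fps_nth (D j) 0 = 0" 
      proof (cases j)
        case (Suc i)
        show ?thesis unfolding Suc by (subst assms(2)) simp
      qed (simp add: assms(1))
    qed
  next
    case (Suc n)
    show ?case
    proof
      fix j show "fps_nth (D j) (Suc n) = 0"
      proof (cases j)
        case (Suc i)
        show ?thesis unfolding Suc assms(2) using Suc.IH by (simp add: fps_sum_nth)
      qed (simp add: assms(1))
    qed
  qed
  then show ?thesis by (intro fps_ext) simp
qed

text \<open>
  A walk needs at least \<open>j\<close> steps to descend from \<open>j\<close> to 0.
\<close>

lemma half_line_recursion_order:
  fixes D :: "nat \<Rightarrow> complex fps"
  assumes "\<And>j. D (Suc j) = fps_X * (D j + (\<Sum>k\<le>p. fps_const (c k j) * D (Suc j + k)))"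
    and "n < j"
  shows "fps_nth (D j) n = 0"
  using assms(2)
proof (induction n arbitrary: j)
  case 0
  then obtain i where i: "j = Suc i" by (cases j) auto
  show ?case unfolding i by (subst assms(1)) simp
next
  case (Suc n)
  then obtain i where i: "j = Suc i" "n < i" by (cases j) auto
  have "fps_nth (D (Suc i + k)) n = 0" for k using Suc.IH[of "Suc i + k"] i(2) by simp
  then show ?case unfolding i(1) assms(1) using Suc.IH[of i] i(2) by (simp add: fps_sum_nth)
qed

lemma sum_shift_telescope:
  fixes t :: "nat \<Rightarrow> 'a::ab_group_add"
  shows "(\<Sum>j<N. t j - t (j + Suc k)) = (\<Sum>i\<le>k. t i) - (\<Sum>i\<in>{N..<N + Suc k}. t i)"
proof -
  have "(\<Sum>j<N. t j) + (\<Sum>i\<in>{N..<N + Suc k}. t i) = (\<Sum>i<N + Suc k. t i)"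
    by (subst sum.union_disjoint[symmetric]) (auto simp del: add_Suc_right sum.lessThan_Suc intro!: sum.cong)
  also have "\<dots> = (\<Sum>i\<le>k. t i) + (\<Sum>j<N. t (j + Suc k))"
  proof -
    have split: "{..<N + Suc k} = {..k} \<union> {Suc k..<N + Suc k}" by auto
    have "(\<Sum>i<N + Suc k. t i) = (\<Sum>i\<le>k. t i) + (\<Sum>i\<in>{Suc k..<N + Suc k}. t i)"
      unfolding split by (rule sum.union_disjoint) auto
    also have "(\<Sum>i\<in>{Suc k..<N + Suc k}. t i) = (\<Sum>j<N. t (j + Suc k))"
      by (rule sum.reindex_bij_witness[of _ "\<lambda>j. j + Suc k" "\<lambda>i. i - Suc k"]) auto
    finally show ?thesis .
  qed
  finally show ?thesis by (simp add: sum_subtractf algebra_simps)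
qed

text \<open>
  Let \<open>v j\<close> generate the walks from \<open>j\<close> to 0, let \<open>\<phi> j\<close> generate the first passages from \<open>j\<close> down
  to 0, and let \<open>\<psi> j\<close> generate the reflected reversals of the walks from 0 to \<open>- j\<close> that stay
  negative after the start; the reversal is why the weights in the recursion for \<open>\<psi>\<close> are taken at
  the shifted position \<open>- j - k\<close>. A descent to 0 from \<open>j \<ge> 0\<close> splits at its first visit of 0, so
  \<open>v j = \<phi> j * v 0\<close>. For negative positions pair \<open>v\<close> with \<open>\<psi>\<close>: inserting both recursions into \<open>\<psi> j
  * v (- j) - \<psi> (j + 1) * v (- j - 1)\<close> cancels the downward steps, and on summation over \<open>j\<close> every
  jump that stays below 0 cancels too. What is left are the jumps that reach or cross 0 and, from
  cutting the sum off at \<open>N\<close>, terms of order greater than \<open>N\<close>.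
\<close>

lemma closed_walk_series:
  fixes x :: "nat \<Rightarrow> int \<Rightarrow> complex" and v :: "int \<Rightarrow> complex fps" and \<phi> \<psi> :: "nat \<Rightarrow> complex fps"
  assumes v: "\<And>j. v j = (if j = 0 then 1 else 0) +
        fps_X * (v (j - 1) + (\<Sum>k\<le>p. fps_const (x k j) * v (j + int k)))"
    and \<phi>0: "\<phi> 0 = 1"
    and \<phi>: "\<And>j. \<phi> (Suc j) =
        fps_X * (\<phi> j + (\<Sum>k\<le>p. fps_const (x k (int (Suc j))) * \<phi> (Suc j + k)))"
    and \<psi>0: "\<psi> 0 = 1"
    and \<psi>: "\<And>j. \<psi> (Suc j) =
        fps_X * (\<psi> j + (\<Sum>k\<le>p. fps_const (x k (- int (Suc j) - int k)) * \<psi> (Suc j + k)))"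
  shows "v 0 * (1 - fps_X * (\<Sum>k=0..p. \<Sum>j=0..k. fps_const (x k (- int j)) * \<phi> (k - j) * \<psi> j)) = 1"
proof -
  have up: "v (int j) = \<phi> j * v 0" for j
  proof -
    have "v (int j) - \<phi> j * v 0 = 0"
    proof (rule half_line_recursion_unique[where D = "\<lambda>j. v (int j) - \<phi> j * v 0"
            and c = "\<lambda>k j. x k (int (Suc j))" and p = p])
      fix j
      have "v (int (Suc j)) = fps_X * (v (int j) +
          (\<Sum>k\<le>p. fps_const (x k (int (Suc j))) * v (int (Suc j + k))))"
        by (subst v) (simp add: add_ac)
      then show "v (int (Suc j)) - \<phi> (Suc j) * v 0 = fps_X * (v (int j) - \<phi> j * v 0 +
          (\<Sum>k\<le>p. fps_const (x k (int (Suc j))) * (v (int (Suc j + k)) - \<phi> (Suc j + k) * v 0)))"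
        unfolding \<phi>
        by (simp add: ring_distribs sum_distrib_right sum_distrib_left sum_subtractf mult_ac)
    qed (simp add: \<phi>0)
    then show ?thesis by simp
  qed
  \<comment> \<open>Walks that begin with a \<open>\<psi>\<close>-part ending at \<open>- j\<close>, jump by \<open>k\<close>, and then return to 0 freely.\<close>
  define t where "t = (\<lambda>k j. fps_const (x k (- int j)) * \<psi> j * v (int k - int j))"
  have step: "\<psi> j * v (- int j) - \<psi> (Suc j) * v (- int (Suc j)) =
      (if j = 0 then 1 else 0) + fps_X * (\<Sum>k\<le>p. t k j - t k (j + Suc k))" for j
  proof -
    have neg: "- int (Suc j) = - int j - 1" by simp
    have "\<psi> j * v (- int j) = (if j = 0 then 1 else 0) + fps_X * \<psi> j * v (- int (Suc j)) +
        fps_X * (\<Sum>k\<le>p. t k j)"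
      unfolding neg by (subst v) (auto simp: \<psi>0 t_def ring_distribs sum_distrib_left mult_ac add_ac)
    moreover have "\<psi> (Suc j) * v (- int (Suc j)) = fps_X * \<psi> j * v (- int (Suc j)) +
        fps_X * (\<Sum>k\<le>p. t k (j + Suc k))"
      unfolding \<psi> by (simp add: t_def ring_distribs sum_distrib_left mult_ac add_ac algebra_simps)
    ultimately show ?thesis by (simp add: ring_distribs sum_subtractf)
  qed
  have tele: "v 0 - \<psi> (Suc N) * v (- int (Suc N)) = 1 + fps_X *
      (\<Sum>k\<le>p. (\<Sum>i\<le>k. t k i) - (\<Sum>i\<in>{Suc N..<Suc N + Suc k}. t k i))" for N
  proof -
    have "v 0 - \<psi> (Suc N) * v (- int (Suc N)) =
        (\<Sum>j<Suc N. \<psi> j * v (- int j) - \<psi> (Suc j) * v (- int (Suc j)))"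
      by (subst sum_lessThan_telescope'[where f = "\<lambda>j. \<psi> j * v (- int j)"]) (simp add: \<psi>0)
    also have "\<dots> = (\<Sum>j<Suc N. if j = 0 then 1 else 0) +
        fps_X * (\<Sum>j<Suc N. \<Sum>k\<le>p. t k j - t k (j + Suc k))"
      unfolding step sum.distrib sum_distrib_left ..
    also have "(\<Sum>j<Suc N. if j = 0 then 1 else 0) = (1 :: complex fps)" by simp
    also have "(\<Sum>j<Suc N. \<Sum>k\<le>p. t k j - t k (j + Suc k)) =
        (\<Sum>k\<le>p. (\<Sum>i\<le>k. t k i) - (\<Sum>i\<in>{Suc N..<Suc N + Suc k}. t k i))"
      by (subst sum.swap) (simp only: sum_shift_telescope)
    finally show ?thesis .
  qed
  have order: "fps_nth (\<psi> j) n = 0" if "n < j" for n j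
    using that by (rule half_line_recursion_order[where D = \<psi>, OF \<psi>])
  have order_mult: "fps_nth (A * \<psi> j * B) n = 0" if "n < j" for n j A B
    using that by (auto simp: fps_mult_nth order intro!: sum.neutral)
  \<comment> \<open>To compare coefficients of index \<open>n\<close>, cut the sum off at \<open>N = n\<close>: the remainder starts later.\<close>
  have "v 0 = 1 + fps_X * (\<Sum>k\<le>p. \<Sum>i\<le>k. t k i)"
  proof (rule fps_ext)
    fix n
    have "fps_nth (\<psi> (Suc n) * v (- int (Suc n))) n = 0"
      using order_mult[of n "Suc n" 1] by simp
    moreover have "fps_nth (\<Sum>i\<in>{Suc n..<Suc n + Suc k}. t k i) m = 0" if "m \<le> n" for k m
      using that unfolding fps_sum_nth t_def by (intro sum.neutral ballI order_mult) auto
    ultimately show "fps_nth (v 0) n = fps_nth (1 + fps_X * (\<Sum>k\<le>p. \<Sum>i\<le>k. t k i)) n"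
      using arg_cong[OF tele[of n], of "\<lambda>f. fps_nth f n"]
      by (simp add: fps_sum_nth fps_sub_nth)
  qed
  also have "(\<Sum>k\<le>p. \<Sum>i\<le>k. t k i) =
      (\<Sum>k=0..p. \<Sum>j=0..k. fps_const (x k (- int j)) * \<phi> (k - j) * \<psi> j) * v 0"
    unfolding sum_distrib_right atLeast0AtMost
  proof (intro sum.cong refl)
    fix k i :: nat assume "i \<in> {..k}"
    then have "v (int k - int i) = \<phi> (k - i) * v 0" using up[of "k - i"] by (simp add: of_nat_diff)
    then show "t k i = fps_const (x k (- int i)) * \<phi> (k - i) * \<psi> i * v 0"
      by (simp add: t_def mult_ac)
  qed
  finally show ?thesis by (simp add: algebra_simps)
qed

section \<open>Weyl functions as power series\<close>

text \<open>
  The expansion of the \<open>j\<close>-th Weyl function in \<open>w = 1 / z\<close>: the Neumann series of the resolvent.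
\<close>

definition weyl_fps :: "nat \<Rightarrow> (nat \<Rightarrow> nat \<Rightarrow> complex) \<Rightarrow> nat \<Rightarrow> complex fps" where
  "weyl_fps p a j =
     (if j = 0 then 1 else fps_X * Abs_fps (\<lambda>m. (hess_op p a ^^ m) (l2_basis j) 0))"

lemma hess_op_sum:
  "hess_op p a (\<lambda>n. \<Sum>s\<in>S. c s * y s n) = (\<lambda>n. \<Sum>s\<in>S. c s * hess_op p a (y s) n)"
proof
  fix i
  have "(\<Sum>k\<le>p. if k \<le> i then a k (Suc (i - k)) * (\<Sum>s\<in>S. c s * y s (i - k)) else 0) =
      (\<Sum>k\<le>p. \<Sum>s\<in>S. c s * (if k \<le> i then a k (Suc (i - k)) * y s (i - k) else 0))"
    by (intro sum.cong refl) (simp add: sum_distrib_left mult_ac)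
  also have "\<dots> = (\<Sum>s\<in>S. c s * (\<Sum>k\<le>p. if k \<le> i then a k (Suc (i - k)) * y s (i - k) else 0))"
    by (subst sum.swap) (simp add: sum_distrib_left)
  finally show "hess_op p a (\<lambda>n. \<Sum>s\<in>S. c s * y s n) i = (\<Sum>s\<in>S. c s * hess_op p a (y s) i)"
    unfolding hess_op_eq by (simp add: ring_distribs sum.distrib)
qed

lemma hess_op_funpow_sum:
  "(hess_op p a ^^ m) (\<lambda>n. \<Sum>s\<in>S. c s * y s n) = (\<lambda>n. \<Sum>s\<in>S. c s * (hess_op p a ^^ m) (y s) n)"
  by (induction m) (simp_all add: hess_op_sum)

text \<open>
  Rows are finite, so the operator commutes with coordinatewise convergent series.
\<close>

lemma hess_op_sums:
  assumes "\<And>n. (\<lambda>m. f m n) sums r n"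
  shows "(\<lambda>m. hess_op p a (f m) n) sums hess_op p a r n"
  unfolding hess_op_eq
proof (intro sums_add sums_sum assms)
  fix k
  show "(\<lambda>m. if k \<le> n then a k (Suc (n - k)) * f m (n - k) else 0) sums
      (if k \<le> n then a k (Suc (n - k)) * r (n - k) else 0)"
    by (cases "k \<le> n") (simp_all add: sums_mult assms)
qed

text \<open>
  Column \<open>j + 1\<close> of the matrix. For \<open>j = 0\<close> this relies on \<open>l2_basis 0\<close> being the zero sequence.
\<close>

lemma hess_op_basis:
  "hess_op p a (l2_basis (Suc j)) =
     (\<lambda>i. l2_basis j i + (\<Sum>k\<le>p. a k (Suc j) * l2_basis (Suc j + k) i))"
proof
  fix i
  have "hess_op p a (l2_basis (Suc j)) i = hess_entry p a (Suc i) (Suc j)"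
    unfolding hess_op_def by (subst suminf_finite[of "{j}"]) (auto simp: l2_basis_def)
  also have "\<dots> = l2_basis j i + (\<Sum>k\<le>p. if k = i - j \<and> j \<le> i then a k (Suc j) else 0)"
    by (auto simp: hess_entry_def l2_basis_def sum.If_cases)
  also have "(\<Sum>k\<le>p. if k = i - j \<and> j \<le> i then a k (Suc j) else 0) =
      (\<Sum>k\<le>p. a k (Suc j) * l2_basis (Suc j + k) i)"
    by (intro sum.cong refl) (auto simp: l2_basis_def)
  finally show "hess_op p a (l2_basis (Suc j)) i =
      l2_basis j i + (\<Sum>k\<le>p. a k (Suc j) * l2_basis (Suc j + k) i)" .
qed

text \<open>
  The recursion for Weyl functions splits off the first step of a walk, that is, the rightmost
  factor of a power of the operator, whereas iteration adds factors on the left; linearity of the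
  powers makes up for this.
\<close>

lemma hess_op_funpow_basis_Suc:
  "(hess_op p a ^^ Suc m) (l2_basis (Suc j)) n = (hess_op p a ^^ m) (l2_basis j) n +
     (\<Sum>k\<le>p. a k (Suc j) * (hess_op p a ^^ m) (l2_basis (Suc j + k)) n)"
proof -
  \<comment> \<open>The downward step is indexed by \<open>None\<close>, the jump by \<open>k\<close> by \<open>Some k\<close>.\<close>
  define c where "c = (\<lambda>s. case s of None \<Rightarrow> 1 | Some k \<Rightarrow> a k (Suc j))"
  define y where "y = (\<lambda>s. case s of None \<Rightarrow> l2_basis j | Some k \<Rightarrow> l2_basis (Suc j + k))"
  let ?S = "insert None (Some ` {..p})"
  have S: "(\<Sum>s\<in>?S. g s) = g None + (\<Sum>k\<le>p. g (Some k))" for g :: "nat option \<Rightarrow> complex"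
    by (subst sum.insert) (auto simp: sum.reindex)
  have "hess_op p a (l2_basis (Suc j)) = (\<lambda>i. \<Sum>s\<in>?S. c s * y s i)"
    unfolding hess_op_basis S by (simp add: c_def y_def)
  then have "(hess_op p a ^^ Suc m) (l2_basis (Suc j)) n =
      (\<Sum>s\<in>?S. c s * (hess_op p a ^^ m) (y s) n)"
    unfolding funpow_Suc_right comp_def by (simp only: hess_op_funpow_sum)
  then show ?thesis unfolding S by (simp add: c_def y_def)
qed

lemma hess_op_funpow_zero: "(hess_op p a ^^ m) (l2_basis 0) = (\<lambda>_. 0)"
  by (induction m) (simp_all add: l2_basis_def hess_op_def)

text \<open>
  The recursion for first passages to 0 that \<open>closed_walk_series\<close> requires. It holds with the
  value 1 at 0, because the factor \<open>fps_X\<close> in \<open>weyl_fps\<close> stands for the last step, from 1 to 0.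
\<close>

lemma weyl_fps_Suc:
  "weyl_fps p a (Suc j) = fps_X * (weyl_fps p a j +
     (\<Sum>k\<le>p. fps_const (a k (Suc j)) * weyl_fps p a (Suc j + k)))"
proof -
  let ?q = "\<lambda>m j. (hess_op p a ^^ m) (l2_basis j) 0"
  have "Abs_fps (\<lambda>m. ?q m (Suc j)) =
      weyl_fps p a j + (\<Sum>k\<le>p. fps_const (a k (Suc j)) * weyl_fps p a (Suc j + k))"
  proof (rule fps_ext)
    fix n
    show "fps_nth (Abs_fps (\<lambda>m. ?q m (Suc j))) n = fps_nth (weyl_fps p a j +
        (\<Sum>k\<le>p. fps_const (a k (Suc j)) * weyl_fps p a (Suc j + k))) n"
    proof (cases n)
      case 0
      then show ?thesis by (auto simp: weyl_fps_def fps_sum_nth l2_basis_def)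
    next
      case (Suc m)
      have "fps_nth (weyl_fps p a j) (Suc m) = ?q m j"
        by (simp add: weyl_fps_def hess_op_funpow_zero)
      then show ?thesis
        unfolding Suc fps_nth_Abs_fps hess_op_funpow_basis_Suc
        by (simp add: fps_sum_nth) (simp add: weyl_fps_def)
    qed
  qed
  then show ?thesis by (simp add: weyl_fps_def)
qed

context
  fixes p :: nat and a :: "nat \<Rightarrow> nat \<Rightarrow> complex" and C :: real
  assumes bounded: "\<And>k n. k \<le> p \<Longrightarrow> n \<ge> 1 \<Longrightarrow> cmod (a k n) \<le> C"
begin

lemma entry_bound_nonneg: "C \<ge> 0"
  using norm_ge_zero[of "a 0 1"] bounded[of 0 1] by linarith

text \<open>
  The constant \<open>1 + (p + 1) C\<close> bounds the absolute row sums, and also the absolute column sums.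
\<close>

lemma hess_op_sup_bound:
  assumes "\<And>n. cmod (x n) \<le> S"
  shows "cmod (hess_op p a x n) \<le> (1 + real (Suc p) * C) * S"
proof -
  have S: "S \<ge> 0" using norm_ge_zero[of "x 0"] assms[of 0] by linarith
  have "cmod (hess_op p a x n) \<le> cmod (x (Suc n)) +
      (\<Sum>k\<le>p. cmod (if k \<le> n then a k (Suc (n - k)) * x (n - k) else 0))"
    unfolding hess_op_eq by (intro norm_triangle_le add_left_mono norm_sum)
  also have "\<dots> \<le> S + (\<Sum>k\<le>p. C * S)"
    using bounded assms S entry_bound_nonneg by (intro add_mono sum_mono) (auto simp: norm_mult intro!: mult_mono)
  finally show ?thesis by (simp add: algebra_simps)
qed

lemma hess_op_l1_bound:
  assumes "\<And>N. (\<Sum>n<N. cmod (x n)) \<le> S"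
  shows "(\<Sum>n<N. cmod (hess_op p a x n)) \<le> (1 + real (Suc p) * C) * S"
proof -
  have S: "S \<ge> 0" using assms[of 0] by simp
  have "(\<Sum>n<N. cmod (hess_op p a x n)) \<le> (\<Sum>n<N. cmod (x (Suc n)) +
      (\<Sum>k\<le>p. cmod (if k \<le> n then a k (Suc (n - k)) * x (n - k) else 0)))"
    unfolding hess_op_eq by (intro sum_mono norm_triangle_le add_left_mono norm_sum)
  also have "\<dots> = (\<Sum>n<N. cmod (x (Suc n))) +
      (\<Sum>k\<le>p. \<Sum>n<N. cmod (if k \<le> n then a k (Suc (n - k)) * x (n - k) else 0))"
    by (subst sum.swap) (simp add: sum.distrib)
  also have "\<dots> \<le> S + (\<Sum>k\<le>p. C * S)"
  proof (intro add_mono sum_mono)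
    have "(\<Sum>n<N. cmod (x (Suc n))) \<le> (\<Sum>n<Suc N. cmod (x n))"
      by (subst sum.lessThan_Suc_shift) simp
    then show "(\<Sum>n<N. cmod (x (Suc n))) \<le> S" using assms[of "Suc N"] by linarith
  next
    fix k assume k: "k \<in> {..p}"
    have "(\<Sum>n<N. cmod (if k \<le> n then a k (Suc (n - k)) * x (n - k) else 0)) =
        (\<Sum>n\<in>{k..<N}. cmod (a k (Suc (n - k)) * x (n - k)))"
      by (rule sum.mono_neutral_cong_right) auto
    also have "\<dots> = (\<Sum>n<N - k. cmod (a k (Suc n) * x n))"
      by (rule sum.reindex_bij_witness[of _ "\<lambda>n. n + k" "\<lambda>n. n - k"]) auto
    also have "\<dots> \<le> (\<Sum>n<N - k. C * cmod (x n))"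
      using bounded k by (intro sum_mono) (auto simp: norm_mult intro!: mult_right_mono)
    also have "\<dots> \<le> C * S"
      unfolding sum_distrib_left[symmetric] using assms entry_bound_nonneg by (intro mult_left_mono)
    finally show "(\<Sum>n<N. cmod (if k \<le> n then a k (Suc (n - k)) * x (n - k) else 0)) \<le> C * S" .
  qed
  finally show ?thesis by (simp add: algebra_simps)
qed

lemma hess_op_funpow_basis_l1_bound:
  "(\<Sum>n<N. cmod ((hess_op p a ^^ m) (l2_basis j) n)) \<le> (1 + real (Suc p) * C) ^ m"
proof (induction m arbitrary: N)
  case 0
  have "(\<Sum>n<N. cmod (l2_basis j n)) = (\<Sum>n\<in>{..<N} \<inter> {j - 1}. cmod (l2_basis j n))"
    by (rule sum.mono_neutral_right) (auto simp: l2_basis_def)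
  also have "\<dots> \<le> 1" by (cases "j - 1 < N") (auto simp: l2_basis_def)
  finally show ?case by simp
next
  case (Suc m)
  then show ?case using hess_op_l1_bound[of _ "(1 + real (Suc p) * C) ^ m" N] by simp
qed

text \<open>
  A square-summable sequence is bounded, and a bounded sequence \<open>d\<close> with \<open>z d = T d\<close> shrinks by a
  constant factor less than 1 each time the supremum bound is applied to it.
\<close>

lemma hess_op_resolvent_injective:
  assumes z: "cmod z > 1 + real (Suc p) * C"
  shows "inj_on (\<lambda>x n. z * x n - hess_op p a x n) l2"
proof (rule inj_onI)
  fix x y assume x: "x \<in> l2" and y: "y \<in> l2"
    and eq: "(\<lambda>n. z * x n - hess_op p a x n) = (\<lambda>n. z * y n - hess_op p a y n)"
  define d where "d = (\<lambda>n. x n - y n)"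
  have dT: "hess_op p a d n = z * d n" for n
  proof -
    have "(\<Sum>k\<le>p. if k \<le> n then a k (Suc (n - k)) * d (n - k) else 0) =
        (\<Sum>k\<le>p. (if k \<le> n then a k (Suc (n - k)) * x (n - k) else 0) -
          (if k \<le> n then a k (Suc (n - k)) * y (n - k) else 0))"
      by (intro sum.cong refl) (simp add: d_def right_diff_distrib)
    then have "hess_op p a d n = hess_op p a x n - hess_op p a y n"
      unfolding hess_op_eq by (simp add: d_def sum_subtractf)
    also have "\<dots> = z * x n - z * y n" using fun_cong[OF eq, of n] by (simp add: algebra_simps)
    finally show ?thesis by (simp add: d_def right_diff_distrib)
  qed
  have "\<exists>B. \<forall>n. cmod (u n) \<le> B" if "u \<in> l2" for u
  proof -
    have "(\<lambda>n. (cmod (u n))\<^sup>2) \<longlonglongrightarrow> 0"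
      using that by (intro summable_LIMSEQ_zero) (simp add: l2_def)
    then have "u \<longlonglongrightarrow> 0" by (simp add: tendsto_norm_zero_iff)
    then show ?thesis by (meson Bseq_def convergentI convergent_imp_Bseq)
  qed
  from this[OF x] this[OF y] obtain B1 B2 where "\<forall>n. cmod (x n) \<le> B1" "\<forall>n. cmod (y n) \<le> B2"
    by blast
  then have dB: "cmod (d n) \<le> B1 + B2" for n
    unfolding d_def by (intro norm_triangle_le_diff add_mono) auto
  define \<rho> where "\<rho> = (1 + real (Suc p) * C) / cmod z"
  have D: "1 + real (Suc p) * C > 0" using entry_bound_nonneg by (simp add: add_pos_nonneg)
  have \<rho>: "0 \<le> \<rho>" "\<rho> < 1"
    unfolding \<rho>_def using z D by (simp, subst divide_less_eq_1_pos) linarith+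
  have it: "cmod (d n) \<le> \<rho> ^ m * (B1 + B2)" for m n
  proof (induction m arbitrary: n)
    case 0
    then show ?case using dB by simp
  next
    case (Suc m)
    have "cmod z * cmod (d n) \<le> (1 + real (Suc p) * C) * (\<rho> ^ m * (B1 + B2))"
      using hess_op_sup_bound[of d, OF Suc.IH, of n] unfolding dT norm_mult .
    then have "cmod (d n) \<le> (1 + real (Suc p) * C) * (\<rho> ^ m * (B1 + B2)) / cmod z"
      using z D by (subst pos_le_divide_eq) (linarith, simp only: mult.commute)
    then show ?case by (simp add: \<rho>_def mult.assoc)
  qed
  have "d n = 0" for n
  proof -
    have "(\<lambda>m. \<rho> ^ m * (B1 + B2)) \<longlonglongrightarrow> 0 * (B1 + B2)"
      using \<rho> by (intro tendsto_intros LIMSEQ_power_zero) auto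
    then have "cmod (d n) \<le> 0 * (B1 + B2)"
      by (rule LIMSEQ_le_const) (use it in auto)
    then show ?thesis by simp
  qed
  then show "x = y" by (auto simp: d_def)
qed

text \<open>
  The Neumann series applied to a basis vector converges in the \<open>\<ell>\<^sup>1\<close>-norm. Its sum is therefore
  square-summable, and by injectivity it is the value of the resolvent.
\<close>

lemma weyl_sums:
  assumes z: "cmod z > 1 + real (Suc p) * C" and j: "j \<ge> 1"
  shows "(\<lambda>m. (hess_op p a ^^ m) (l2_basis j) 0 / z ^ Suc m) sums weyl p a j z"
proof -
  define D where "D = 1 + real (Suc p) * C"
  define q where "q = (\<lambda>m. (hess_op p a ^^ m) (l2_basis j))"
  define r where "r = (\<lambda>n. \<Sum>m. q m n / z ^ Suc m)"
  have D: "D > 0" unfolding D_def using entry_bound_nonneg by (simp add: add_pos_nonneg)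
  have z0: "cmod z > 0" "cmod z > D" using z D unfolding D_def by linarith+
  have geo: "summable (\<lambda>m. D ^ m / cmod z ^ Suc m)"
    using summable_mult[OF summable_geometric[of "D / cmod z"], of "1 / cmod z"] D z0
    by (simp add: power_divide)
  have l1: "(\<Sum>n<N. cmod (q m n)) \<le> D ^ m" for m N
    unfolding q_def D_def by (rule hess_op_funpow_basis_l1_bound)
  have qn: "cmod (q m n) \<le> D ^ m" for m n
    using member_le_sum[of n "{..<Suc n}" "\<lambda>n. cmod (q m n)"] l1[where N = "Suc n" and m = m] by simp
  have sn: "summable (\<lambda>m. cmod (q m n / z ^ Suc m))" for n
    by (rule summable_comparison_test'[OF geo, of 0])
       (use qn z0 in \<open>auto simp: norm_divide norm_mult norm_power intro!: divide_right_mono\<close>)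
  have rs: "(\<lambda>m. q m n / z ^ Suc m) sums r n" for n
    unfolding r_def by (intro summable_sums summable_norm_cancel[OF sn])
  have rsum: "(\<Sum>n<N. cmod (r n)) \<le> (\<Sum>m. D ^ m / cmod z ^ Suc m)" for N
  proof -
    have "(\<Sum>n<N. cmod (r n)) \<le> (\<Sum>n<N. \<Sum>m. cmod (q m n / z ^ Suc m))"
      unfolding r_def by (intro sum_mono summable_norm sn)
    also have "\<dots> = (\<Sum>m. \<Sum>n<N. cmod (q m n / z ^ Suc m))"
      by (intro suminf_sum[symmetric] sn)
    also have "\<dots> \<le> (\<Sum>m. D ^ m / cmod z ^ Suc m)"
    proof (intro suminf_le geo summable_sum sn)
      fix m
      have "(\<Sum>n<N. cmod (q m n / z ^ Suc m)) = (\<Sum>n<N. cmod (q m n)) / cmod z ^ Suc m"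
        by (simp add: norm_divide norm_mult norm_power sum_divide_distrib)
      then show "(\<Sum>n<N. cmod (q m n / z ^ Suc m)) \<le> D ^ m / cmod z ^ Suc m"
        using l1[of m N] z0 by (simp add: divide_right_mono)
    qed
    finally show ?thesis .
  qed
  have "summable (\<lambda>n. cmod (r n))"
    by (rule bounded_imp_summable[where B = "\<Sum>m. D ^ m / cmod z ^ Suc m"])
       (use rsum[of "Suc _"] in \<open>auto simp: lessThan_Suc_atMost\<close>)
  then have r_l2: "r \<in> l2"
  proof -
    assume s: "summable (\<lambda>n. cmod (r n))"
    then have "(\<lambda>n. cmod (r n)) \<longlonglongrightarrow> 0" by (rule summable_LIMSEQ_zero)
    then have "\<forall>\<^sub>F n in sequentially. cmod (r n) < 1" by (rule order_tendstoD) simp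
    then have "\<forall>\<^sub>F n in sequentially. norm ((cmod (r n))\<^sup>2) \<le> cmod (r n)"
      by eventually_elim (simp add: power2_eq_square mult_left_le)
    then have "summable (\<lambda>n. (cmod (r n))\<^sup>2)" by (rule summable_comparison_test_ev[OF _ s])
    then show ?thesis by (simp add: l2_def)
  qed
  have solve: "(\<lambda>n. z * r n - hess_op p a r n) = l2_basis j"
  proof
    fix n
    have "hess_op p a (\<lambda>n. q m n / z ^ Suc m) n = q (Suc m) n / z ^ Suc m" for m
      using hess_op_sum[of p a "\<lambda>_. 1 / z ^ Suc m" "\<lambda>_. q m" "{()}"] by (simp add: q_def)
    then have "(\<lambda>m. q (Suc m) n / z ^ Suc m) sums hess_op p a r n"
      using hess_op_sums[where f = "\<lambda>m n. q m n / z ^ Suc m" and r = r, OF rs, of p a n] by simp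
    then have "(\<lambda>m. q m n / z ^ m) sums (hess_op p a r n + q 0 n)"
      using sums_Suc[of "\<lambda>m. q m n / z ^ m"] by simp
    moreover have "(\<lambda>m. q m n / z ^ m) sums (z * r n)"
      using sums_mult[OF rs[of n], of z] z0 by simp
    ultimately have "z * r n = hess_op p a r n + q 0 n" by (rule sums_unique2[rotated])
    then show "z * r n - hess_op p a r n = l2_basis j n" by (simp add: q_def)
  qed
  have "l2_resolvent (hess_op p a) z (l2_basis j) = r"
    unfolding l2_resolvent_def solve[symmetric]
    by (rule inv_into_f_f[OF hess_op_resolvent_injective[OF z] r_l2])
  then have "weyl p a j z = r 0" using j by (simp add: weyl_def l2_inner_basis)
  then show ?thesis using rs[of 0] by (simp add: q_def)
qed

lemma weyl_has_fps_expansion: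
  "(\<lambda>w. if w = 0 then fps_nth (weyl_fps p a j) 0 else weyl p a j (1 / w))
     has_fps_expansion weyl_fps p a j"
proof (cases "j = 0")
  case True
  then have "weyl_fps p a j = 1"
    and "(\<lambda>w. if w = 0 then fps_nth (weyl_fps p a j) 0 else weyl p a j (1 / w)) = (\<lambda>_. 1)"
    by (auto simp: weyl_fps_def weyl_def)
  then show ?thesis by simp
next
  case False
  define D where "D = 1 + real (Suc p) * C"
  have D: "D > 0" unfolding D_def using entry_bound_nonneg by (simp add: add_pos_nonneg)
  let ?F = "weyl_fps p a j"
  have "eventually (\<lambda>w. cmod w < 1 / D) (nhds 0)"
    using eventually_nhds_in_open[of "ball 0 (1 / D)" "0::complex"] D by simp
  then have "eventually (\<lambda>w. (\<lambda>n. fps_nth ?F n * w ^ n) sums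
      (if w = 0 then fps_nth ?F 0 else weyl p a j (1 / w))) (nhds 0)"
  proof eventually_elim
    case (elim w)
    show ?case
    proof (cases "w = 0")
      case True
      then show ?thesis using powser_sums_zero[of "fps_nth ?F"] by simp
    next
      case w: False
      have "cmod (1 / w) > 1 + real (Suc p) * C"
        using elim w D unfolding D_def[symmetric] by (simp add: norm_divide field_simps)
      from weyl_sums[OF this, of j] False
      have "(\<lambda>m. fps_nth ?F (Suc m) * w ^ Suc m) sums weyl p a j (1 / w)"
        by (simp add: weyl_fps_def power_divide)
      moreover have "fps_nth ?F 0 = 0" using False by (simp add: weyl_fps_def)
      ultimately show ?thesis
        using sums_Suc[of "\<lambda>n. fps_nth ?F n * w ^ n"] w by simp
    qed
  qed
  then show ?thesis by (rule has_fps_expansionI)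
qed

end

text \<open>
  With \<open>w = 1 / z\<close> the function \<open>W\<close> becomes \<open>w / (1 - w s(w))\<close> for an analytic function \<open>s\<close>, so
  the Laurent expansion at infinity is a power series in \<open>w\<close> without constant term.
\<close>

lemma laurent_coeff_W_fun:
  assumes a: "\<And>k n. k \<le> p \<Longrightarrow> n \<ge> 1 \<Longrightarrow> cmod (a k n) \<le> C"
    and b: "\<And>k n. k \<le> p \<Longrightarrow> n \<ge> 1 \<Longrightarrow> cmod (b k n) \<le> C"
  shows "laurent_coeff_infinity (W_fun p \<alpha> a b) (int l + 1) =
    fps_nth (inverse (1 - fps_X *
      (\<Sum>k=0..p. \<Sum>j=0..k. fps_const (\<alpha> k j) * weyl_fps p a (k - j) * weyl_fps p b j))) l"
proof -
  let ?S = "\<Sum>k=0..p. \<Sum>j=0..k. fps_const (\<alpha> k j) * weyl_fps p a (k - j) * weyl_fps p b j"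
  define A where "A = (\<lambda>j w. if w = 0 then fps_nth (weyl_fps p a j) 0 else weyl p a j (1 / w))"
  define B where "B = (\<lambda>j w. if w = 0 then fps_nth (weyl_fps p b j) 0 else weyl p b j (1 / w))"
  define s where "s = (\<lambda>w. \<Sum>k=0..p. \<Sum>j=0..k. \<alpha> k j * A (k - j) w * B j w)"
  have A: "A j has_fps_expansion weyl_fps p a j" for j
    unfolding A_def by (rule weyl_has_fps_expansion[OF a])
  have B: "B j has_fps_expansion weyl_fps p b j" for j
    unfolding B_def by (rule weyl_has_fps_expansion[OF b])
  have s: "s has_fps_expansion ?S"
    unfolding s_def by (intro has_fps_expansion_sum has_fps_expansion_mult has_fps_expansion_const A B)
  have "(\<lambda>w. w * inverse (1 - w * s w)) has_fps_expansion fps_X * inverse (1 - fps_X * ?S)"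
    by (intro has_fps_expansion_mult has_fps_expansion_inverse has_fps_expansion_diff
        has_fps_expansion_fps_X s) auto
  then have "(\<lambda>w. w * inverse (1 - w * s w)) has_laurent_expansion
      fps_to_fls (fps_X * inverse (1 - fps_X * ?S))"
    by (rule has_laurent_expansion_fps)
  moreover have ev: "\<forall>\<^sub>F w in at 0. w * inverse (1 - w * s w) = W_fun p \<alpha> a b (1 / w)"
  proof (rule eventually_mono[OF eventually_neq_at_within[of 0]])
    fix w :: complex assume w: "w \<noteq> 0"
    then have "W_fun p \<alpha> a b (1 / w) = 1 / (1 / w - s w)"
      by (simp add: W_fun_def s_def A_def B_def)
    also have "1 / w - s w = (1 - w * s w) / w" using w by (simp add: field_simps)
    finally show "w * inverse (1 - w * s w) = W_fun p \<alpha> a b (1 / w)" by (simp add: divide_inverse)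
  qed
  ultimately have "(\<lambda>w. W_fun p \<alpha> a b (1 / w)) has_laurent_expansion
      fps_to_fls (fps_X * inverse (1 - fps_X * ?S))"
    using has_laurent_expansion_cong[OF ev refl] by blast
  then have "laurent_expansion (\<lambda>w. W_fun p \<alpha> a b (1 / w)) 0 =
      fps_to_fls (fps_X * inverse (1 - fps_X * ?S))"
    by (rule laurent_expansion_0_eqI)
  then have "laurent_coeff_infinity (W_fun p \<alpha> a b) (int l + 1) =
      fls_nth (fps_to_fls (fps_X * inverse (1 - fps_X * ?S))) (int (Suc l))"
    unfolding laurent_coeff_infinity_def by (simp add: add.commute)
  also have "\<dots> = fps_nth (fps_X * inverse (1 - fps_X * ?S)) (Suc l)"
    unfolding fps_to_fls_nth nat_int by simp
  also have "\<dots> = fps_nth (inverse (1 - fps_X * ?S)) l" by simp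
  finally show ?thesis .
qed

section \<open>Laurent coefficients of W as weights of closed walks\<close>

text \<open>
  The weights for which \<open>W\<close> generates the closed walks at 0. A jump by \<open>k\<close> from \<open>m \<le> 0\<close> ends at \<open>m
  + k\<close>; it belongs to \<open>\<alpha>\<close> if this is nonnegative. Otherwise its reflected reversal starts at \<open>- m
  - k \<ge> 1\<close>, which is the index used for \<open>b\<close>.
\<close>

definition two_sided ::
    "(nat \<Rightarrow> nat \<Rightarrow> 'a) \<Rightarrow> (nat \<Rightarrow> nat \<Rightarrow> 'a) \<Rightarrow> (nat \<Rightarrow> nat \<Rightarrow> 'a) \<Rightarrow> nat \<Rightarrow> int \<Rightarrow> 'a" where
  "two_sided \<alpha> a b k m =
     (if m \<ge> 1 then a k (nat m)
      else if m \<ge> - int k then \<alpha> k (nat (- m))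
      else b k (nat (- m - int k)))"

lemma laurent_coeff_W_fun_eq_walk:
  assumes a: "\<And>k n. k \<le> p \<Longrightarrow> n \<ge> 1 \<Longrightarrow> cmod (a k n) \<le> C"
    and b: "\<And>k n. k \<le> p \<Longrightarrow> n \<ge> 1 \<Longrightarrow> cmod (b k n) \<le> C"
  shows "laurent_coeff_infinity (W_fun p \<alpha> a b) (int l + 1) =
    walk p (\<lambda>_. 1) (two_sided \<alpha> a b) l 0"
proof -
  let ?x = "two_sided \<alpha> a b"
  define v where "v = (\<lambda>j. Abs_fps (\<lambda>l. walk p (\<lambda>_. 1) ?x l j))"
  let ?S = "\<Sum>k=0..p. \<Sum>j=0..k. fps_const (?x k (- int j)) * weyl_fps p a (k - j) * weyl_fps p b j"
  have "v 0 * (1 - fps_X * ?S) = 1"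
  proof (rule closed_walk_series)
    show "v j = (if j = 0 then 1 else 0) +
        fps_X * (v (j - 1) + (\<Sum>k\<le>p. fps_const (?x k j) * v (j + int k)))" for j
      unfolding v_def by (rule walk_fps)
    show "weyl_fps p a (Suc j) = fps_X * (weyl_fps p a j +
        (\<Sum>k\<le>p. fps_const (?x k (int (Suc j))) * weyl_fps p a (Suc j + k)))" for j
      by (subst weyl_fps_Suc) (simp add: two_sided_def nat_add_distrib)
    show "weyl_fps p b (Suc j) = fps_X * (weyl_fps p b j +
        (\<Sum>k\<le>p. fps_const (?x k (- int (Suc j) - int k)) * weyl_fps p b (Suc j + k)))" for j
      by (subst weyl_fps_Suc) (simp add: two_sided_def nat_add_distrib)
  qed (simp_all add: weyl_fps_def)
  then have "(1 - fps_X * ?S) * v 0 = 1" by (simp only: mult.commute)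
  then have "v 0 = inverse (1 - fps_X * ?S)" by (rule fps_inverse_unique[symmetric])
  also have "?S = (\<Sum>k=0..p. \<Sum>j=0..k. fps_const (\<alpha> k j) * weyl_fps p a (k - j) * weyl_fps p b j)"
    by (intro sum.cong refl) (simp add: two_sided_def)
  finally have "fps_nth (v 0) l = laurent_coeff_infinity (W_fun p \<alpha> a b) (int l + 1)"
    using laurent_coeff_W_fun[where \<alpha> = \<alpha>, OF a b] by (simp only:)
  then show ?thesis by (simp add: v_def)
qed

section \<open>Moments of the eigenvalue distribution\<close>

lemma trace_mult_commute:
  fixes A B :: "'a::comm_semiring_0 mat"
  assumes "A \<in> carrier_mat n m" "B \<in> carrier_mat m n"
  shows "(\<Sum>i<n. (A * B) $$ (i, i)) = (\<Sum>i<m. (B * A) $$ (i, i))"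
proof -
  have "(\<Sum>i<n. (A * B) $$ (i, i)) = (\<Sum>i<n. \<Sum>j<m. A $$ (i, j) * B $$ (j, i))"
    using assms by (intro sum.cong refl) (auto simp: scalar_prod_def atLeast0LessThan)
  also have "\<dots> = (\<Sum>j<m. \<Sum>i<n. B $$ (j, i) * A $$ (i, j))"
    by (subst sum.swap) (simp add: mult.commute)
  also have "\<dots> = (\<Sum>i<m. (B * A) $$ (i, i))"
    using assms by (intro sum.cong refl) (auto simp: scalar_prod_def atLeast0LessThan)
  finally show ?thesis .
qed

lemma upper_triangular_pow:
  fixes B :: "'a::comm_ring_1 mat"
  assumes B: "B \<in> carrier_mat n n" "upper_triangular B"
  shows "i < n \<Longrightarrow> j \<le> i \<Longrightarrow> (B ^\<^sub>m l) $$ (i, j) = (if j = i then (B $$ (i, i)) ^ l else 0)"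
proof (induction l arbitrary: i j)
  case 0
  then show ?case using B by simp
next
  case (Suc l)
  have z: "B $$ (k, j) = 0" if "j < k" "k < n" for k using B that by auto
  have "(B ^\<^sub>m Suc l) $$ (i, j) = (\<Sum>k<n. (B ^\<^sub>m l) $$ (i, k) * B $$ (k, j))"
    using B Suc.prems by (simp add: scalar_prod_def atLeast0LessThan)
  also have "\<dots> = (\<Sum>k<n. if k = i \<and> j = i then (B $$ (i, i)) ^ l * B $$ (i, i) else 0)"
  proof (intro sum.cong refl)
    fix k assume k: "k \<in> {..<n}"
    show "(B ^\<^sub>m l) $$ (i, k) * B $$ (k, j) =
        (if k = i \<and> j = i then (B $$ (i, i)) ^ l * B $$ (i, i) else 0)"
    proof (cases "k \<le> i")
      case True
      then show ?thesis using Suc.IH[of i k] Suc.prems z[of i] by auto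
    next
      case False
      then show ?thesis using z[of k] k Suc.prems by auto
    qed
  qed
  also have "\<dots> = (if j = i then (B $$ (i, i)) ^ Suc l else 0)"
    using Suc.prems by (auto simp: mult.commute)
  finally show ?case .
qed

text \<open>
  By the Schur decomposition the matrix is similar to an upper triangular one with the eigenvalues
  on the diagonal. The powers of the two matrices are similar as well, hence have the same trace.
\<close>

lemma eigenvalue_power_sum:
  fixes A :: "complex mat"
  assumes A: "A \<in> carrier_mat n n"
  shows "(\<Sum>x\<in>#proots (char_poly A). x ^ l) = (\<Sum>i<n. (A ^\<^sub>m l) $$ (i, i))"
    and "size (proots (char_poly A)) = n"
proof -
  obtain as where as: "char_poly A = (\<Prod>a\<leftarrow>as. [:- a, 1:])" using char_poly_factorized[OF A] by blast
  obtain B P Q where BPQ: "schur_decomposition A as = (B, P, Q)" by (metis prod_cases3)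
  from schur_decomposition[OF A as BPQ]
  have sim: "similar_mat_wit A B P Q" and ut: "upper_triangular B" and diag: "diag_mat B = as"
    by auto
  from similar_mat_witD2[OF A sim] have PQ: "Q * P = 1\<^sub>m n"
    and B: "B \<in> carrier_mat n n" and P: "P \<in> carrier_mat n n" and Q: "Q \<in> carrier_mat n n"
    by auto
  have roots: "proots (char_poly A) = mset as"
  proof -
    have "proots (\<Prod>a\<leftarrow>as. [:- a, 1:]) = mset as"
    proof (induction as)
      case (Cons a as)
      have "(\<Prod>a\<leftarrow>as. [:- a, 1:]) \<noteq> 0" by (auto simp: prod_list_zero_iff)
      then show ?case using Cons.IH by (simp add: proots_mult del: mult_pCons_left)
    qed simp
    then show ?thesis unfolding as .
  qed
  show "size (proots (char_poly A)) = n"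
    unfolding roots using arg_cong[OF diag, of length] B by (simp add: diag_mat_def)
  have pw: "A ^\<^sub>m l = P * B ^\<^sub>m l * Q" by (rule similar_mat_wit_pow_id[OF sim])
  have Bl: "B ^\<^sub>m l \<in> carrier_mat n n" using B by simp
  have "(\<Sum>i<n. (A ^\<^sub>m l) $$ (i, i)) = (\<Sum>i<n. (Q * (P * B ^\<^sub>m l)) $$ (i, i))"
    unfolding pw using P Q Bl by (intro trace_mult_commute) auto
  also have "Q * (P * B ^\<^sub>m l) = B ^\<^sub>m l"
    using assoc_mult_mat[OF Q P Bl, symmetric] PQ left_mult_one_mat[OF Bl] by simp
  also have "(\<Sum>i<n. (B ^\<^sub>m l) $$ (i, i)) = (\<Sum>i<n. (B $$ (i, i)) ^ l)"
    using upper_triangular_pow[OF B ut] by simp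
  also have "\<dots> = (\<Sum>x\<leftarrow>as. x ^ l)"
    unfolding diag[symmetric] diag_mat_def using B
    by (simp add: o_def interv_sum_list_conv_sum_set_nat atLeast0LessThan)
  also have "\<dots> = (\<Sum>x\<in>#proots (char_poly A). x ^ l)"
    unfolding roots by (metis mset_map sum_mset_sum_list)
  finally show "(\<Sum>x\<in>#proots (char_poly A). x ^ l) = (\<Sum>i<n. (A ^\<^sub>m l) $$ (i, i))" ..
qed

lemma sum_mset_conv_count:
  fixes f :: "'a \<Rightarrow> 'b::comm_semiring_1"
  assumes "finite S" "set_mset R \<subseteq> S"
  shows "(\<Sum>x\<in>#R. f x) = (\<Sum>x\<in>S. of_nat (count R x) * f x)"
  using assms(2)
proof (induction R)
  case (add a R)
  have "(\<Sum>x\<in>S. of_nat (count (add_mset a R) x) * f x) =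
      (\<Sum>x\<in>S. of_nat (count R x) * f x + (if x = a then f x else 0))"
    by (intro sum.cong refl) (auto simp: algebra_simps)
  also have "\<dots> = (\<Sum>x\<in>S. of_nat (count R x) * f x) + f a"
    using add.prems assms(1) by (simp add: sum.distrib)
  finally show ?case using add by (simp add: add.commute)
qed simp

lemma eigenvalue_distribution_moment:
  fixes A :: "complex mat"
  assumes A: "A \<in> carrier_mat n n" and n: "n > 0"
  shows "(\<integral>x. x ^ l \<partial>measure_pmf (eigenvalue_distribution A)) =
    (\<Sum>i<n. (A ^\<^sub>m l) $$ (i, i)) / of_nat n"
proof -
  let ?R = "proots (char_poly A)"
  have size: "size ?R = n" by (rule eigenvalue_power_sum(2)[OF A])
  then have ne: "?R \<noteq> {#}" using n by auto
  have "(\<integral>x. x ^ l \<partial>measure_pmf (pmf_of_multiset ?R)) =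
      (\<Sum>x\<in>set_mset ?R. pmf (pmf_of_multiset ?R) x *\<^sub>R x ^ l)"
    using ne by (subst integral_measure_pmf[where A = "set_mset ?R"]) auto
  also have "\<dots> = (\<Sum>x\<in>set_mset ?R. of_nat (count ?R x) * x ^ l) / of_nat n"
    using ne by (simp add: size scaleR_conv_of_real sum_divide_distrib)
  also have "(\<Sum>x\<in>set_mset ?R. of_nat (count ?R x) * x ^ l) = (\<Sum>x\<in>#?R. x ^ l)"
    by (rule sum_mset_conv_count[symmetric]) auto
  finally show ?thesis unfolding eigenvalue_distribution_def eigenvalue_power_sum(1)[OF A] .
qed

section \<open>Diagonal entries of powers of the truncated matrix\<close>

text \<open>
  The walks are shifted by \<open>i\<close> so that they end at 0, and confined to \<open>0 \<le> int i + m < n\<close> by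
  giving weight 0 to steps that would leave this range. Matrix indices start at 0, those of the
  sequences at 1.
\<close>

lemma hess_mat_pow_eq_walk:
  assumes "i < n" "j < n"
  shows "(hess_mat p a n ^\<^sub>m l) $$ (i, j) =
    walk p (\<lambda>m. if int i + m \<ge> 1 then 1 else 0)
      (\<lambda>k m. if 0 \<le> int i + m \<and> int i + m + int k < int n then a k (Suc (nat (int i + m))) else 0)
      l (int j - int i)"
    (is "_ = walk p ?d ?x l _")
  using assms(2)
proof (induction l arbitrary: j)
  case 0
  then show ?case using assms by (auto simp: hess_mat_def)
next
  case (Suc l)
  let ?H = "hess_mat p a n"
  let ?w = "\<lambda>m. walk p ?d ?x l (m - int i)"
  have H: "?H \<in> carrier_mat n n" by (simp add: hess_mat_def)
  have "(?H ^\<^sub>m Suc l) $$ (i, j) = (\<Sum>m<n. (?H ^\<^sub>m l) $$ (i, m) * ?H $$ (m, j))"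
    using H assms Suc.prems by (simp add: scalar_prod_def atLeast0LessThan)
  also have "\<dots> = (\<Sum>m<n. hess_entry p a (Suc m) (Suc j) * ?w (int m))"
    using Suc by (intro sum.cong refl) (simp add: hess_mat_def mult.commute)
  also have "\<dots> = (\<Sum>m<n. (if j = Suc m then ?w (int m) else 0) +
      (if j \<le> m \<and> m \<le> j + p then a (m - j) (Suc j) * ?w (int m) else 0))"
    by (intro sum.cong refl) (auto simp: hess_entry_def)
  also have "\<dots> = (\<Sum>m<n. if j = Suc m then ?w (int m) else 0) +
      (\<Sum>m<n. if j \<le> m \<and> m \<le> j + p then a (m - j) (Suc j) * ?w (int m) else 0)"
    by (rule sum.distrib)
  also have "(\<Sum>m<n. if j = Suc m then ?w (int m) else 0) = ?d (int j - int i) * ?w (int j - 1)"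
    using Suc.prems by (cases j) auto
  also have "(\<Sum>m<n. if j \<le> m \<and> m \<le> j + p then a (m - j) (Suc j) * ?w (int m) else 0) =
      (\<Sum>m\<in>{j..<n} \<inter> {..j + p}. a (m - j) (Suc j) * ?w (int m))"
    by (rule sum.mono_neutral_cong_right) auto
  also have "\<dots> = (\<Sum>k\<in>{k. k \<le> p \<and> j + k < n}. a k (Suc j) * ?w (int (j + k)))"
    by (rule sum.reindex_bij_witness[of _ "\<lambda>k. j + k" "\<lambda>m. m - j"]) auto
  also have "\<dots> = (\<Sum>k\<le>p. ?x k (int j - int i) * ?w (int j + int k))"
    by (rule sum.mono_neutral_cong_left) auto
  finally show ?case by (simp add: algebra_simps)
qed

lemma hess_mat_pow_diag_bulk:
  assumes "l * p + l + p < i" "i + (l * p + l + p) < n"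
  shows "(hess_mat p a n ^\<^sub>m l) $$ (i, i) =
    walk p (\<lambda>_. 1) (\<lambda>k m. a k (Suc (nat (int i + m)))) l 0"
proof -
  define R where "R = l * p + l"
  have R: "int R + int p < int i" "int i + int R + int p < int n" and i: "i < n"
    using assms unfolding R_def by linarith+
  show ?thesis
    unfolding hess_mat_pow_eq_walk[OF i i] diff_self
    by (rule walk_local; fold R_def) (use R in auto)
qed

lemma hess_mat_pow_diag_bound:
  assumes a: "\<And>k n. k \<le> p \<Longrightarrow> n \<ge> 1 \<Longrightarrow> cmod (a k n) \<le> C" and i: "i < n"
  shows "cmod ((hess_mat p a n ^\<^sub>m l) $$ (i, i)) \<le> (real (p + 2) * max 1 C) ^ l"
  unfolding hess_mat_pow_eq_walk[OF i i] using a
  by (intro walk_bound) (auto intro: order.trans[OF _ max.cobounded2])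

lemma average_tendsto_bulk_value:
  fixes e :: "nat \<Rightarrow> nat \<Rightarrow> complex"
  assumes B: "\<And>n i. i < n \<Longrightarrow> cmod (e n i) \<le> B"
    and g: "\<And>n i. R < i \<Longrightarrow> i + R < n \<Longrightarrow> e n i = g"
  shows "(\<lambda>n. (\<Sum>i<n. e n i) / of_nat n) \<longlonglongrightarrow> g"
proof -
  let ?K = "real (2 * R + 1) * (B + cmod g)"
  have bound: "cmod ((\<Sum>i<n. e n i) / of_nat n - g) \<le> ?K / real n" if n: "n > 0" for n
  proof -
    have B0: "B + cmod g \<ge> 0" using B[OF n] norm_ge_zero[of "e n 0"] norm_ge_zero[of g] by linarith
    have "(\<Sum>i<n. e n i) / of_nat n - g = (\<Sum>i<n. e n i - g) / of_nat n"
      using n by (simp add: sum_subtractf field_simps)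
    also have "(\<Sum>i<n. e n i - g) = (\<Sum>i\<in>{..<n} \<inter> ({..R} \<union> {n - R..<n}). e n i - g)"
    proof (rule sum.mono_neutral_right)
      show "\<forall>i\<in>{..<n} - {..<n} \<inter> ({..R} \<union> {n - R..<n}). e n i - g = 0"
      proof
        fix i assume "i \<in> {..<n} - {..<n} \<inter> ({..R} \<union> {n - R..<n})"
        then have "R < i" "i + R < n" by auto
        then show "e n i - g = 0" using g by simp
      qed
    qed auto
    finally have "cmod ((\<Sum>i<n. e n i) / of_nat n - g) =
        cmod (\<Sum>i\<in>{..<n} \<inter> ({..R} \<union> {n - R..<n}). e n i - g) / real n"
      by (simp add: norm_divide)
    also have "cmod (\<Sum>i\<in>{..<n} \<inter> ({..R} \<union> {n - R..<n}). e n i - g) \<le>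
        real (card ({..<n} \<inter> ({..R} \<union> {n - R..<n}))) * (B + cmod g)"
    proof (rule order.trans[OF norm_sum], rule sum_bounded_above)
      fix i assume "i \<in> {..<n} \<inter> ({..R} \<union> {n - R..<n})"
      then show "cmod (e n i - g) \<le> B + cmod g"
        using B[of i n] by (intro order.trans[OF norm_triangle_ineq4]) auto
    qed
    also have "\<dots> \<le> ?K"
    proof (intro mult_right_mono B0)
      have "card ({..<n} \<inter> ({..R} \<union> {n - R..<n})) \<le> card ({..R} \<union> {n - R..<n})"
        by (rule card_mono) auto
      also have "\<dots> \<le> card {..R} + card {n - R..<n}" by (rule card_Un_le)
      also have "\<dots> \<le> 2 * R + 1" by simp
      finally show "real (card ({..<n} \<inter> ({..R} \<union> {n - R..<n}))) \<le> real (2 * R + 1)" by linarith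
    qed
    finally show ?thesis by (simp add: divide_right_mono)
  qed
  have "(\<lambda>n. (\<Sum>i<n. e n i) / of_nat n - g) \<longlonglongrightarrow> 0"
  proof (rule Lim_null_comparison)
    show "\<forall>\<^sub>F n in sequentially. cmod ((\<Sum>i<n. e n i) / of_nat n - g) \<le> ?K / real n"
      using eventually_gt_at_top[of 0] by eventually_elim (rule bound)
    show "(\<lambda>n. ?K / real n) \<longlonglongrightarrow> 0" by (rule lim_const_over_n)
  qed
  then show ?thesis by (simp add: LIM_zero_iff)
qed

section \<open>Independence of the two-sided array\<close>

context prob_space
begin

lemma indep_vars_reindex_inj:
  assumes h: "inj_on h I" "h ` I \<subseteq> J" and X: "indep_vars (\<lambda>_. N) X J"
  shows "indep_vars (\<lambda>_. N) (\<lambda>i. X (h i)) I"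
  unfolding indep_vars_def2
proof (intro conjI ballI indep_setsI)
  have J: "\<forall>j\<in>J. random_variable N (X j)"
    and ind: "indep_sets (\<lambda>j. {X j -` A \<inter> space M | A. A \<in> sets N}) J"
    using X unfolding indep_vars_def2 by auto
  show "random_variable N (X (h i))" if "i \<in> I" for i using J h that by auto
  then show "{X (h i) -` A \<inter> space M | A. A \<in> sets N} \<subseteq> events" if "i \<in> I" for i
    using that by (auto intro: measurable_sets)
  fix A K assume K: "K \<noteq> {}" "K \<subseteq> I" "finite K"
    and A: "\<forall>i\<in>K. A i \<in> {X (h i) -` B \<inter> space M | B. B \<in> sets N}"
  have inj: "inj_on h K" using h(1) K(2) by (rule inj_on_subset)
  let ?g = "the_inv_into K h"
  have g: "?g (h i) = i" if "i \<in> K" for i using inj that by (rule the_inv_into_f_f)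
  have "prob (\<Inter>j\<in>h ` K. A (?g j)) = (\<Prod>j\<in>h ` K. prob (A (?g j)))"
    by (rule indep_setsD[OF ind]) (use K h A g in auto)
  also have "(\<Inter>j\<in>h ` K. A (?g j)) = (\<Inter>i\<in>K. A i)" using g by auto
  also have "(\<Prod>j\<in>h ` K. prob (A (?g j))) = (\<Prod>i\<in>K. prob (A i))"
    using inj g by (simp add: prod.reindex)
  finally show "prob (\<Inter>i\<in>K. A i) = (\<Prod>i\<in>K. prob (A i))" .
qed

lemma cylinder_event_preimage:
  assumes L: "finite L" "L \<noteq> {}" and W: "W \<in> measurable M Q"
    and h: "\<And>i. i \<in> L \<Longrightarrow> h i \<in> measurable Q N"
      "\<And>i \<omega>. i \<in> L \<Longrightarrow> \<omega> \<in> space M \<Longrightarrow> X i \<omega> = h i (W \<omega>)"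
    and A: "\<And>i. i \<in> L \<Longrightarrow> A i \<in> {X i -` B \<inter> space M | B. B \<in> sets N}"
  shows "(\<Inter>i\<in>L. A i) \<in> {W -` E \<inter> space M | E. E \<in> sets Q}"
proof -
  have "\<forall>i\<in>L. \<exists>B. B \<in> sets N \<and> A i = X i -` B \<inter> space M" using A by blast
  then obtain B where B: "\<And>i. i \<in> L \<Longrightarrow> B i \<in> sets N" "\<And>i. i \<in> L \<Longrightarrow> A i = X i -` B i \<inter> space M"
    by metis
  have "(\<Inter>i\<in>L. h i -` B i \<inter> space Q) \<in> sets Q"
    using L h(1) B(1) by (intro sets.finite_INT) (auto intro: measurable_sets)
  moreover have "(\<Inter>i\<in>L. A i) = W -` (\<Inter>i\<in>L. h i -` B i \<inter> space Q) \<inter> space M"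
    using L(2) h(2) B(2) measurable_space[OF W] by auto
  ultimately show ?thesis by blast
qed

text \<open>
  An event that confines finitely many members of the union to measurable sets is the intersection
  of an event in terms of \<open>U\<close> and one in terms of \<open>V\<close>. Its probability factors first into the
  probabilities of these two, and then within each of the families.
\<close>

lemma indep_vars_Un:
  assumes X: "indep_vars (\<lambda>_. N) X I" "indep_vars (\<lambda>_. N) X J" and disj: "I \<inter> J = {}"
    and UV: "indep_random_elements M S U T V"
    and f: "\<And>i. i \<in> I \<Longrightarrow> f i \<in> measurable S N" "\<And>i \<omega>. i \<in> I \<Longrightarrow> \<omega> \<in> space M \<Longrightarrow> X i \<omega> = f i (U \<omega>)"
    and g: "\<And>j. j \<in> J \<Longrightarrow> g j \<in> measurable T N" "\<And>j \<omega>. j \<in> J \<Longrightarrow> \<omega> \<in> space M \<Longrightarrow> X j \<omega> = g j (V \<omega>)"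
  shows "indep_vars (\<lambda>_. N) X (I \<union> J)"
  unfolding indep_vars_def2
proof (intro conjI ballI indep_setsI)
  let ?F = "\<lambda>i. {X i -` A \<inter> space M | A. A \<in> sets N}"
  have rv: "random_variable N (X i)" if "i \<in> I \<union> J" for i
    using X that unfolding indep_vars_def2 by auto
  then show "random_variable N (X i)" if "i \<in> I \<union> J" for i using that .
  show "?F i \<subseteq> events" if "i \<in> I \<union> J" for i
    using rv[OF that] by (auto intro: measurable_sets)
  have indI: "indep_sets ?F I" and indJ: "indep_sets ?F J"
    using X unfolding indep_vars_def2 by auto
  have U: "U \<in> measurable M S" and V: "V \<in> measurable M T"
    and ind: "indep_set (sigma_sets (space M) {U -` A \<inter> space M | A. A \<in> sets S})
      (sigma_sets (space M) {V -` A \<inter> space M | A. A \<in> sets T})"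
    using UV unfolding indep_random_elements_def by auto
  fix A K assume K: "K \<noteq> {}" "K \<subseteq> I \<union> J" "finite K" and A: "\<forall>i\<in>K. A i \<in> ?F i"
  show "prob (\<Inter>i\<in>K. A i) = (\<Prod>i\<in>K. prob (A i))"
  proof (cases "K \<inter> I = {} \<or> K \<inter> J = {}")
    case True
    then have "K \<subseteq> J \<or> K \<subseteq> I" using K(2) by blast
    then show ?thesis by (elim disjE indep_setsD[OF indI _ K(1,3) A] indep_setsD[OF indJ _ K(1,3) A])
  next
    case False
    let ?K1 = "K \<inter> I" and ?K2 = "K \<inter> J"
    have KE: "K = ?K1 \<union> ?K2" using K(2) by blast
    have "(\<Inter>i\<in>K. A i) = (\<Inter>i\<in>?K1. A i) \<inter> (\<Inter>i\<in>?K2. A i)" using K(2) by blast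
    moreover have "(\<Inter>i\<in>?K1. A i) \<in> {U -` E \<inter> space M | E. E \<in> sets S}"
      by (rule cylinder_event_preimage[where h = f and X = X and N = N]) (use False K A U f in auto)
    moreover have "(\<Inter>i\<in>?K2. A i) \<in> {V -` E \<inter> space M | E. E \<in> sets T}"
      by (rule cylinder_event_preimage[where h = g and X = X and N = N]) (use False K A V g in auto)
    ultimately have "prob (\<Inter>i\<in>K. A i) = prob (\<Inter>i\<in>?K1. A i) * prob (\<Inter>i\<in>?K2. A i)"
      using indep_setD[OF ind sigma_sets.Basic sigma_sets.Basic] by simp
    moreover have "prob (\<Inter>i\<in>?K1. A i) = (\<Prod>i\<in>?K1. prob (A i))"
      by (rule indep_setsD[OF indI]) (use False K A in auto)
    moreover have "prob (\<Inter>i\<in>?K2. A i) = (\<Prod>i\<in>?K2. prob (A i))"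
      by (rule indep_setsD[OF indJ]) (use False K A in auto)
    moreover have "(\<Prod>i\<in>K. prob (A i)) = (\<Prod>i\<in>?K1. prob (A i)) * (\<Prod>i\<in>?K2. prob (A i))"
      by (subst KE, rule prod.union_disjoint) (use K disj in auto)
    ultimately show ?thesis by simp
  qed
qed

text \<open>
  The joint distribution of an independent family is the product of its marginals.
\<close>

lemma indep_vars_expectation_cong:
  fixes G :: "('i \<Rightarrow> 'b) \<Rightarrow> complex"
  assumes X: "indep_vars (\<lambda>_. N) X I" and Y: "indep_vars (\<lambda>_. N) Y I" and I: "I \<noteq> {}"
    and XY: "\<And>i. i \<in> I \<Longrightarrow> distr M N (X i) = distr M N (Y i)"
    and G: "G \<in> borel_measurable (\<Pi>\<^sub>M i\<in>I. N)"
  shows "expectation (\<lambda>\<omega>. G (\<lambda>i\<in>I. X i \<omega>)) = expectation (\<lambda>\<omega>. G (\<lambda>i\<in>I. Y i \<omega>))"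
proof -
  have rv: "random_variable N (X i)" "random_variable N (Y i)" if "i \<in> I" for i
    using X Y that unfolding indep_vars_def2 by auto
  have "distr M (\<Pi>\<^sub>M i\<in>I. N) (\<lambda>\<omega>. \<lambda>i\<in>I. X i \<omega>) = (\<Pi>\<^sub>M i\<in>I. distr M N (X i))"
    by (rule iffD1[OF indep_vars_iff_distr_eq_PiM'[OF I rv(1)] X])
  also have "\<dots> = (\<Pi>\<^sub>M i\<in>I. distr M N (Y i))" by (rule PiM_cong) (use XY in auto)
  also have "\<dots> = distr M (\<Pi>\<^sub>M i\<in>I. N) (\<lambda>\<omega>. \<lambda>i\<in>I. Y i \<omega>)"
    by (rule iffD1[OF indep_vars_iff_distr_eq_PiM'[OF I rv(2)] Y, symmetric])
  finally have eq: "distr M (\<Pi>\<^sub>M i\<in>I. N) (\<lambda>\<omega>. \<lambda>i\<in>I. X i \<omega>) =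
      distr M (\<Pi>\<^sub>M i\<in>I. N) (\<lambda>\<omega>. \<lambda>i\<in>I. Y i \<omega>)" .
  have "expectation (\<lambda>\<omega>. G (\<lambda>i\<in>I. Z i \<omega>)) = integral\<^sup>L (distr M (\<Pi>\<^sub>M i\<in>I. N) (\<lambda>\<omega>. \<lambda>i\<in>I. Z i \<omega>)) G"
    if "\<And>i. i \<in> I \<Longrightarrow> random_variable N (Z i)" for Z
    using that G by (intro integral_distr[symmetric] measurable_restrict)
  from this[of X, OF rv(1)] this[of Y, OF rv(2)] show ?thesis unfolding eq by simp
qed

text \<open>
  The three cases in the definition of \<open>two_sided\<close> partition the index set, and in each of them
  the entries are distinct members of one of the given families. Joining the regions for \<open>a\<close> and
  \<open>b\<close> uses the independence of these two collections; joining the region for \<open>\<alpha>\<close> uses its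
  independence of the pair.
\<close>

lemma two_sided_indep_vars:
  fixes a b \<alpha> :: "nat \<Rightarrow> nat \<Rightarrow> 'a \<Rightarrow> complex"
  assumes a: "indep_vars (\<lambda>_. borel) (\<lambda>(k, n). a k n) (seq_index p)"
    and b: "indep_vars (\<lambda>_. borel) (\<lambda>(k, n). b k n) (seq_index p)"
    and \<alpha>: "indep_vars (\<lambda>_. borel) (\<lambda>(k, j). \<alpha> k j) (tri_index p)"
    and ab: "indep_var
           (\<Pi>\<^sub>M _\<in>seq_index p. borel) (\<lambda>\<omega>. \<lambda>(k, n)\<in>seq_index p. a k n \<omega>)
           (\<Pi>\<^sub>M _\<in>seq_index p. borel) (\<lambda>\<omega>. \<lambda>(k, n)\<in>seq_index p. b k n \<omega>)"
    and \<alpha>ab: "indep_random_elements M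
           (\<Pi>\<^sub>M _\<in>tri_index p. borel) (\<lambda>\<omega>. \<lambda>(k, j)\<in>tri_index p. \<alpha> k j \<omega>)
           ((\<Pi>\<^sub>M _\<in>seq_index p. borel) \<Otimes>\<^sub>M (\<Pi>\<^sub>M _\<in>seq_index p. borel))
           (\<lambda>\<omega>. ((\<lambda>(k, n)\<in>seq_index p. a k n \<omega>), (\<lambda>(k, n)\<in>seq_index p. b k n \<omega>)))"
  shows "indep_vars (\<lambda>_. borel) (\<lambda>(k, m). two_sided \<alpha> a b k m) ({..p} \<times> UNIV)"
proof -
  let ?Z = "\<lambda>(k, m). two_sided \<alpha> a b k m"
  define IA where "IA = {(k, m) | k m. k \<le> p \<and> (1::int) \<le> m}"
  define IB where "IB = {(k, m) | k m. k \<le> p \<and> m < - int k}"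
  define IT where "IT = {(k, m) | k m. k \<le> p \<and> - int k \<le> m \<and> m \<le> 0}"
  define hA where "hA = (\<lambda>(k :: nat, m). (k, nat m))"
  define hB where "hB = (\<lambda>(k, m). (k, nat (- m - int k)))"
  define hT where "hT = (\<lambda>(k :: nat, m). (k, nat (- m)))"
  have memA: "hA i \<in> seq_index p" "?Z i = (\<lambda>(k, n). a k n) (hA i)" if "i \<in> IA" for i
    using that by (auto simp: IA_def hA_def seq_index_def two_sided_def)
  have memB: "hB i \<in> seq_index p" "?Z i = (\<lambda>(k, n). b k n) (hB i)" if "i \<in> IB" for i
    using that by (auto simp: IB_def hB_def seq_index_def two_sided_def)
  have memT: "hT i \<in> tri_index p" "?Z i = (\<lambda>(k, j). \<alpha> k j) (hT i)" if "i \<in> IT" for i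
    using that by (auto simp: IT_def hT_def tri_index_def two_sided_def)
  have injA: "inj_on hA IA" and injB: "inj_on hB IB" and injT: "inj_on hT IT"
    by (auto simp: inj_on_def IA_def IB_def IT_def hA_def hB_def hT_def)
  have ZA: "indep_vars (\<lambda>_. borel) ?Z IA"
    by (rule iffD2[OF indep_vars_cong indep_vars_reindex_inj[OF injA _ a]]) (use memA in auto)
  have ZB: "indep_vars (\<lambda>_. borel) ?Z IB"
    by (rule iffD2[OF indep_vars_cong indep_vars_reindex_inj[OF injB _ b]]) (use memB in auto)
  have ZT: "indep_vars (\<lambda>_. borel) ?Z IT"
    by (rule iffD2[OF indep_vars_cong indep_vars_reindex_inj[OF injT _ \<alpha>]]) (use memT in auto)
  have valA: "?Z i \<omega> = (\<lambda>(k, n)\<in>seq_index p. a k n \<omega>) (hA i)" if "i \<in> IA" for i \<omega>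
    using memA[OF that] by (simp add: case_prod_beta)
  have valB: "?Z i \<omega> = (\<lambda>(k, n)\<in>seq_index p. b k n \<omega>) (hB i)" if "i \<in> IB" for i \<omega>
    using memB[OF that] by (simp add: case_prod_beta)
  have valT: "?Z i \<omega> = (\<lambda>(k, j)\<in>tri_index p. \<alpha> k j \<omega>) (hT i)" if "i \<in> IT" for i \<omega>
    using memT[OF that] by (simp add: case_prod_beta)
  have ZAB: "indep_vars (\<lambda>_. borel) ?Z (IA \<union> IB)"
  proof (rule indep_vars_Un[OF ZA ZB])
    show "IA \<inter> IB = {}" by (auto simp: IA_def IB_def)
    show "indep_random_elements M
        (\<Pi>\<^sub>M _\<in>seq_index p. borel) (\<lambda>\<omega>. \<lambda>(k, n)\<in>seq_index p. a k n \<omega>)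
        (\<Pi>\<^sub>M _\<in>seq_index p. borel) (\<lambda>\<omega>. \<lambda>(k, n)\<in>seq_index p. b k n \<omega>)"
      using ab indep_random_elements_iff_indep_var[OF prob_space_axioms] by blast
    show "(\<lambda>y. y (hA i)) \<in> measurable (\<Pi>\<^sub>M _\<in>seq_index p. borel) borel" if "i \<in> IA" for i
      using memA[OF that] by (intro measurable_component_singleton) auto
    show "(\<lambda>y. y (hB i)) \<in> measurable (\<Pi>\<^sub>M _\<in>seq_index p. borel) borel" if "i \<in> IB" for i
      using memB[OF that] by (intro measurable_component_singleton) auto
  qed (erule valA, erule valB)
  have "indep_vars (\<lambda>_. borel) ?Z (IT \<union> (IA \<union> IB))"
  proof (rule indep_vars_Un[OF ZT ZAB _ \<alpha>ab])
    show "IT \<inter> (IA \<union> IB) = {}" by (auto simp: IA_def IB_def IT_def)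
    show "(\<lambda>y. y (hT i)) \<in> measurable (\<Pi>\<^sub>M _\<in>tri_index p. borel) borel" if "i \<in> IT" for i
      using memT[OF that] by (intro measurable_component_singleton) auto
    show "(\<lambda>y. if i \<in> IA then fst y (hA i) else snd y (hB i)) \<in>
        measurable ((\<Pi>\<^sub>M _\<in>seq_index p. borel) \<Otimes>\<^sub>M (\<Pi>\<^sub>M _\<in>seq_index p. borel)) borel"
      if "i \<in> IA \<union> IB" for i
    proof (cases "i \<in> IA")
      case True
      then show ?thesis using memA[OF True]
        by (simp add: measurable_compose[OF measurable_fst measurable_component_singleton])
    next
      case False
      then have "i \<in> IB" using that by blast
      then show ?thesis using False memB[of i]
        by (simp add: measurable_compose[OF measurable_snd measurable_component_singleton])
    qed
    show "?Z i \<omega> = (\<lambda>(k, j)\<in>tri_index p. \<alpha> k j \<omega>) (hT i)" if "i \<in> IT" for i \<omega>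
      by (rule valT[OF that])
    show "?Z i \<omega> = (if i \<in> IA
        then fst ((\<lambda>(k, n)\<in>seq_index p. a k n \<omega>), (\<lambda>(k, n)\<in>seq_index p. b k n \<omega>)) (hA i)
        else snd ((\<lambda>(k, n)\<in>seq_index p. a k n \<omega>), (\<lambda>(k, n)\<in>seq_index p. b k n \<omega>)) (hB i))"
      if "i \<in> IA \<union> IB" for i \<omega>
      using that valA[of i \<omega>] valB[of i \<omega>] by (simp only: fst_conv snd_conv) auto
  qed
  moreover have "IT \<union> (IA \<union> IB) = {..p} \<times> UNIV"
    by (auto simp: IA_def IB_def IT_def)
  ultimately show ?thesis by simp
qed

text \<open>
  A walk of length \<open>l\<close> sees only the weights in a finite window. The hypotheses are confined to it
  because a one-sided sequence, viewed from one of its positions, satisfies them in such a window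
  only.
\<close>

lemma expectation_walk_cong:
  fixes x y :: "nat \<Rightarrow> int \<Rightarrow> 'a \<Rightarrow> complex"
  assumes x: "indep_vars (\<lambda>_. borel) (\<lambda>(k, m). x k m) ({..p} \<times> {- int (l * p + l)..int (l * p + l)})"
    and y: "indep_vars (\<lambda>_. borel) (\<lambda>(k, m). y k m) ({..p} \<times> {- int (l * p + l)..int (l * p + l)})"
    and xy: "\<And>k m. k \<le> p \<Longrightarrow> \<bar>m\<bar> \<le> int (l * p + l) \<Longrightarrow> distr M borel (x k m) = distr M borel (y k m)"
  shows "expectation (\<lambda>\<omega>. walk p d (\<lambda>k m. x k m \<omega>) l 0) =
    expectation (\<lambda>\<omega>. walk p d (\<lambda>k m. y k m \<omega>) l 0)"
proof -
  define R where "R = l * p + l"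
  let ?J = "{..p} \<times> {- int R..int R}"
  define G where "G = (\<lambda>u. walk p d (\<lambda>k m. if (k, m) \<in> ?J then u (k, m) else 0) l 0)"
  have G: "G \<in> borel_measurable (\<Pi>\<^sub>M _\<in>?J. borel)"
    unfolding G_def
  proof (rule walk_measurable)
    fix k m
    show "(\<lambda>u. if (k, m) \<in> ?J then u (k, m) else 0) \<in> borel_measurable (\<Pi>\<^sub>M _\<in>?J. borel)"
      by (cases "(k, m) \<in> ?J") (auto intro: measurable_component_singleton)
  qed
  have restr: "walk p d (\<lambda>k m. z k m \<omega>) l 0 = G (\<lambda>i\<in>?J. (\<lambda>(k, m). z k m) i \<omega>)"
    for z :: "nat \<Rightarrow> int \<Rightarrow> 'a \<Rightarrow> complex" and \<omega>
    unfolding G_def by (rule walk_local; fold R_def) auto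
  show ?thesis
    unfolding restr
    by (rule indep_vars_expectation_cong[OF x y, folded R_def]) (use xy G R_def in auto)
qed

end

section \<open>The limit of the moments\<close>

theorem theorem1p1:
  fixes M :: "'w measure"
    and p :: nat
    and \<mu> :: "nat \<Rightarrow> complex measure"
    and a b :: "nat \<Rightarrow> nat \<Rightarrow> 'w \<Rightarrow> complex"
    and \<alpha> :: "nat \<Rightarrow> nat \<Rightarrow> 'w \<Rightarrow> complex"
    and C :: real
    and l :: nat
  assumes "p \<ge> 1"
    and "prob_space M"
    and "\<And>k. k \<le> p \<Longrightarrow> prob_space (\<mu> k)"
    and "\<And>k. k \<le> p \<Longrightarrow> sets (\<mu> k) = sets borel"
    and "\<And>k. k \<le> p \<Longrightarrow> compact (measure_support (\<mu> k))"
    and "prob_space.indep_vars M (\<lambda>_. borel) (\<lambda>(k, n). a k n) (seq_index p)"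
    and "prob_space.indep_vars M (\<lambda>_. borel) (\<lambda>(k, n). b k n) (seq_index p)"
    and "prob_space.indep_vars M (\<lambda>_. borel) (\<lambda>(k, j). \<alpha> k j) (tri_index p)"
    and "\<And>k n. k \<le> p \<Longrightarrow> n \<ge> 1 \<Longrightarrow> distr M borel (a k n) = \<mu> k"
    and "\<And>k n. k \<le> p \<Longrightarrow> n \<ge> 1 \<Longrightarrow> distr M borel (b k n) = \<mu> k"
    and "\<And>k j. j \<le> k \<Longrightarrow> k \<le> p \<Longrightarrow> distr M borel (\<alpha> k j) = \<mu> k"
    and "prob_space.indep_var M
           (\<Pi>\<^sub>M _\<in>seq_index p. borel) (\<lambda>\<omega>. \<lambda>(k, n)\<in>seq_index p. a k n \<omega>)
           (\<Pi>\<^sub>M _\<in>seq_index p. borel) (\<lambda>\<omega>. \<lambda>(k, n)\<in>seq_index p. b k n \<omega>)"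
    and "indep_random_elements M
           (\<Pi>\<^sub>M _\<in>tri_index p. borel) (\<lambda>\<omega>. \<lambda>(k, j)\<in>tri_index p. \<alpha> k j \<omega>)
           ((\<Pi>\<^sub>M _\<in>seq_index p. borel) \<Otimes>\<^sub>M (\<Pi>\<^sub>M _\<in>seq_index p. borel))
           (\<lambda>\<omega>. ((\<lambda>(k, n)\<in>seq_index p. a k n \<omega>), (\<lambda>(k, n)\<in>seq_index p. b k n \<omega>)))"
    and "\<And>\<omega> k n. \<omega> \<in> space M \<Longrightarrow> k \<le> p \<Longrightarrow> n \<ge> 1 \<Longrightarrow> cmod (a k n \<omega>) \<le> C"
    and "\<And>\<omega> k n. \<omega> \<in> space M \<Longrightarrow> k \<le> p \<Longrightarrow> n \<ge> 1 \<Longrightarrow> cmod (b k n \<omega>) \<le> C"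
    and "\<And>\<omega> k j. \<omega> \<in> space M \<Longrightarrow> j \<le> k \<Longrightarrow> k \<le> p \<Longrightarrow> cmod (\<alpha> k j \<omega>) \<le> C"
  shows "(\<lambda>n. \<integral>\<omega>. (\<integral>x. x ^ l \<partial>measure_pmf
              (eigenvalue_distribution (hess_mat p (\<lambda>k m. a k m \<omega>) n))) \<partial>M)
         \<longlonglongrightarrow> (\<integral>\<omega>. laurent_coeff_infinity
              (W_fun p (\<lambda>k j. \<alpha> k j \<omega>) (\<lambda>k m. a k m \<omega>) (\<lambda>k m. b k m \<omega>)) (int l + 1) \<partial>M)"
proof -
  interpret prob_space M by fact
  note indep_a = assms(6) and distr_a = assms(9) and distr_b = assms(10) and distr_\<alpha> = assms(11)
    and bound_a = assms(14) and bound_b = assms(15)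
  let ?z = "two_sided \<alpha> a b"
  let ?H = "\<lambda>n \<omega>. hess_mat p (\<lambda>k m. a k m \<omega>) n"
  let ?R = "l * p + l"
  define e where "e = (\<lambda>n i. expectation (\<lambda>\<omega>. (?H n \<omega> ^\<^sub>m l) $$ (i, i)))"
  define g where "g = expectation (\<lambda>\<omega>. laurent_coeff_infinity
      (W_fun p (\<lambda>k j. \<alpha> k j \<omega>) (\<lambda>k m. a k m \<omega>) (\<lambda>k m. b k m \<omega>)) (int l + 1))"
  define B where "B = (real (p + 2) * max 1 C) ^ l"
  have meas_a: "random_variable borel (a k n)" if "k \<le> p" "n \<ge> 1" for k n
    using indep_a that unfolding indep_vars_def2 by (auto simp: seq_index_def)
  have int: "integrable M (\<lambda>\<omega>. (?H n \<omega> ^\<^sub>m l) $$ (i, i))"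
    and bound: "cmod (e n i) \<le> B" if i: "i < n" for n i
  proof -
    have le: "cmod ((?H n \<omega> ^\<^sub>m l) $$ (i, i)) \<le> B" if "\<omega> \<in> space M" for \<omega>
      unfolding B_def using hess_mat_pow_diag_bound[OF bound_a[OF that] i] .
    have "(\<lambda>\<omega>. (?H n \<omega> ^\<^sub>m l) $$ (i, i)) \<in> borel_measurable M"
      unfolding hess_mat_pow_eq_walk[OF i i]
      by (rule walk_measurable) (use meas_a in auto)
    then show int: "integrable M (\<lambda>\<omega>. (?H n \<omega> ^\<^sub>m l) $$ (i, i))"
      by (rule integrable_const_bound[rotated, of _ B]) (use le in auto)
    have "cmod (e n i) \<le> expectation (\<lambda>\<omega>. cmod ((?H n \<omega> ^\<^sub>m l) $$ (i, i)))"
      unfolding e_def by (rule integral_norm_bound)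
    also have "\<dots> \<le> expectation (\<lambda>\<omega>. B)"
      by (rule integral_mono) (use int le in auto)
    finally show "cmod (e n i) \<le> B" by (simp add: prob_space)
  qed
  \<comment> \<open>The limit is the expected weight of the closed walks of length \<open>l\<close> on all of \<open>\<int>\<close>.\<close>
  have g_walk: "g = expectation (\<lambda>\<omega>. walk p (\<lambda>_. 1) (\<lambda>k m. ?z k m \<omega>) l 0)"
  proof -
    have "(\<lambda>k m. ?z k m \<omega>) = two_sided (\<lambda>k j. \<alpha> k j \<omega>) (\<lambda>k m. a k m \<omega>) (\<lambda>k m. b k m \<omega>)" for \<omega>
      by (intro ext) (simp add: two_sided_def)
    then show ?thesis unfolding g_def
      by (intro Bochner_Integration.integral_cong refl)
         (simp add: laurent_coeff_W_fun_eq_walk[OF bound_a bound_b])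
  qed
  \<comment> \<open>Away from the ends, the weights seen from \<open>i\<close> have the same joint distribution as those near 0.\<close>
  have bulk: "e n i = g" if i: "?R + p < i" "i + (?R + p) < n" for n i
  proof -
    let ?J = "{..p} \<times> {- int ?R..int ?R}"
    let ?y = "\<lambda>k m. a k (Suc (nat (int i + m)))"
    let ?h = "\<lambda>(k, m). (k, Suc (nat (int i + m)))"
    define R where "R = ?R"
    have Ri: "int R < int i" using i(1) unfolding R_def by linarith
    have "indep_vars (\<lambda>_. borel) (\<lambda>i. (\<lambda>(k, n). a k n) (?h i)) ({..p} \<times> {- int R..int R})"
      by (rule indep_vars_reindex_inj[OF _ _ indep_a])
         (use Ri in \<open>auto simp: inj_on_def seq_index_def\<close>)
    then have y: "indep_vars (\<lambda>_. borel) (\<lambda>(k, m). ?y k m) ?J"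
      by (simp add: case_prod_beta' R_def)
    have z: "indep_vars (\<lambda>_. borel) (\<lambda>(k, m). ?z k m) ?J"
      by (rule indep_vars_subset[OF two_sided_indep_vars]) (use assms in auto)
    have "e n i = expectation (\<lambda>\<omega>. walk p (\<lambda>_. 1) (\<lambda>k m. ?y k m \<omega>) l 0)"
      unfolding e_def by (subst hess_mat_pow_diag_bulk[OF i]) (rule refl)
    also have "\<dots> = g"
      unfolding g_walk
    proof (rule expectation_walk_cong[OF y z])
      fix k :: nat and m :: int assume k: "k \<le> p"
      have "distr M borel (?z k m) = \<mu> k"
        using k by (auto simp: two_sided_def intro!: distr_a distr_b distr_\<alpha>)
      then show "distr M borel (?y k m) = distr M borel (?z k m)"
        using distr_a[OF k, of "Suc (nat (int i + m))"] by simp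
    qed
    finally show ?thesis .
  qed
  have "(\<lambda>n. (\<Sum>i<n. e n i) / of_nat n) \<longlonglongrightarrow> g"
    by (rule average_tendsto_bulk_value[OF bound bulk])
  moreover have "\<forall>\<^sub>F n in sequentially. (\<Sum>i<n. e n i) / of_nat n =
      (\<integral>\<omega>. (\<integral>x. x ^ l \<partial>measure_pmf (eigenvalue_distribution (?H n \<omega>))) \<partial>M)"
    using eventually_gt_at_top[of 0]
  proof eventually_elim
    case (elim n)
    have "(\<integral>\<omega>. (\<integral>x. x ^ l \<partial>measure_pmf (eigenvalue_distribution (?H n \<omega>))) \<partial>M) =
        (\<integral>\<omega>. (\<Sum>i<n. (?H n \<omega> ^\<^sub>m l) $$ (i, i)) / of_nat n \<partial>M)"
      using elim by (simp add: eigenvalue_distribution_moment[of _ n] hess_mat_def)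
    also have "\<dots> = (\<Sum>i<n. e n i) / of_nat n"
      unfolding e_def integral_divide_zero
      by (subst Bochner_Integration.integral_sum) (use int in auto)
    finally show ?case ..
  qed
  ultimately show ?thesis
    unfolding g_def[symmetric] by (rule Lim_transform_eventually)
qed

end
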